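(* Let $\mathcal V_\alpha$ be a subspace spanned by any $k$ leading eigenvectors of $A$, and let $\mathcal X_0\in\mathrm{Gr}(n,k)$ satisfy $\mathrm{dist}(\mathcal X_0,\mathcal V_\alpha)<\pi/2$. Let $\eta>0$ be a fixed step size with $$\eta\le\frac{\cos(\mathrm{dist}(\mathcal X_0,\mathcal V_\alpha))}{\gamma}.$$ Then the iterates of Riemannian steepest descent $\mathcal X_{t+1}=\mathrm{Exp}_{\mathcal X_t}(-\eta\,\mathrm{grad} f(\mathcal X_t))$ satisfy, for all $t\ge0$, $$f(\mathcal X_t)-f^*\le\frac{2\gamma+\frac1\eta}{4\bigl(\cos(\mathrm{dist}(\mathcal X_0,\mathcal V_\alpha))\,t+1\bigr)}\,\mathrm{dist}^2(\mathcal X_0,\mathcal V_\alpha)$$ (and hence $f(\mathcal X_t)-f^*=\mathcal O(1/t)$).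
   Context: Let $1\le k\le n-1$ and let $A\in\mathbb R^{n\times n}$ be symmetric positive semidefinite with eigenvalues $\lambda_1\ge\cdots\ge\lambda_n$ (with multiplicity). Put $\gamma=2(\lambda_1-\lambda_n)$. A subspace spanned by $k$ leading eigenvectors is $\mathrm{span}(v_1,\dots,v_k)$ with $v_1,\dots,v_k$ orthonormal and $Av_i=\lambda_iv_i$ for $i\le k$. No assumption is made on the eigengap $\lambda_k-\lambda_{k+1}\ge0$. If $\gamma=0$, an upper bound of the form $c/\gamma$ on a step size is regarded as no constraint. $\mathrm{Gr}(n,k)$ is the Grassmann manifold of $k$-dimensional subspaces of $\mathbb R^n$; a subspace $\mathcal X=\mathrm{span}(X)$ is always represented by $X\in\mathbb R^{n\times k}$ with $X^TX=I_k$. Tangent vectors at $\mathcal X$ (for a given representative $X$) are the $G\in\mathbb R^{n\times k}$ with $X^TG=0$; the Riemannian metric is $\langle G_1,G_2\rangle=\mathrm{Tr}(G_1^TG_2)$. Exponential map: $\mathrm{Exp}_{\mathcal X}(G)=\mathrm{span}(XV\cos(\Sigma)+U\sin(\Sigma))$, where $G=U\Sigma V^T$ is a compact SVD with $\Sigma,V\in\mathbb R^{k\times k}$. The principal angles $0\le\theta_1\le\cdots\le\theta_k\le\pi/2$ between $\mathcal X=\mathrm{span}(X)$ and $\mathcal Y=\mathrm{span}(Y)$ are such that $\cos\theta_1,\dots,\cos\theta_k$ are the singular values of $Y^TX$; the Riemannian distance is $\mathrm{dist}(\mathcal X,\mathcal Y)=\sqrt{\theta_1^2+\cdots+\theta_k^2}$.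 The objective is $f:\mathrm{Gr}(n,k)\to\mathbb R$, $f(\mathcal X)=-\mathrm{Tr}(X^TAX)$, with Riemannian gradient $\mathrm{grad}f(\mathcal X)=-2(I-XX^T)AX$ and global minimum $f^*=-(\lambda_1+\cdots+\lambda_k)$. *)

theory Defs
  imports "HOL-Analysis.Analysis" "HOL-Library.Landau_Symbols"
begin

text \<open>
  Throughout, \<open>n = CARD('n)\<close> and \<open>k = CARD('k)\<close>; an \<open>n \<times> k\<close> matrix (\<open>n\<close> rows, \<open>k\<close> columns)
  has type \<open>real^'k^'n\<close>.
\<close>

definition pos_semidef :: "real^'n^'n \<Rightarrow> bool" where
  "pos_semidef A \<longleftrightarrow> transpose A = A \<and> (\<forall>x. 0 \<le> x \<bullet> (A *v x))"

text \<open>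
  \<open>lam 1 \<ge> \<dots> \<ge> lam n\<close> are the eigenvalues of \<open>A\<close> with multiplicity, that is, the roots with
  multiplicity of the characteristic polynomial. Values of \<open>lam\<close> outside \<open>{1..n}\<close> are irrelevant.
\<close>

definition eigenvalues_desc :: "real^'n^'n \<Rightarrow> (nat \<Rightarrow> real) \<Rightarrow> bool" where
  "eigenvalues_desc A lam \<longleftrightarrow>
     antimono_on {1..CARD('n)} lam \<and>
     (\<forall>x. det (mat x - A) = (\<Prod>i=1..CARD('n). (x - lam i)))"

definition leading_eigenspace ::
    "real^'n^'n \<Rightarrow> (nat \<Rightarrow> real) \<Rightarrow> nat \<Rightarrow> (real^'n) set \<Rightarrow> bool" where
  "leading_eigenspace A lam k S \<longleftrightarrow>
     (\<exists>v. (\<forall>i\<in>{1..k}. \<forall>j\<in>{1..k}. v i \<bullet> v j = (if i = j then 1 else 0)) \<and>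
          (\<forall>i\<in>{1..k}. A *v v i = lam i *\<^sub>R v i) \<and>
          S = span (v ` {1..k}))"

text \<open>
  The points of \<open>Gr(n,k)\<close> are the \<open>k\<close>-dimensional subspaces of \<open>real^'n\<close>; \<open>represents X S\<close> says
  that \<open>X\<close> is an orthonormal representative of \<open>S\<close>. The functions below take representatives as
  arguments, since \<open>'k\<close> is not determined by the type of a subspace.
\<close>

definition represents :: "real^'k^'n \<Rightarrow> (real^'n) set \<Rightarrow> bool" where
  "represents X S \<longleftrightarrow> transpose X ** X = mat 1 \<and> span (columns X) = S"

definition diag :: "real^'k \<Rightarrow> real^'k^'k" where
  "diag s = (\<chi> i j. if i = j then s $ i else 0)"

text \<open>Compact singular value decomposition \<open>M = U diag(s) V\<^sup>T\<close>, with \<open>U\<close> of the shape of \<open>M\<close>.\<close>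

definition compact_svd ::
    "real^'k^'m \<Rightarrow> real^'k^'m \<Rightarrow> real^'k \<Rightarrow> real^'k^'k \<Rightarrow> bool" where
  "compact_svd M U s V \<longleftrightarrow>
     transpose U ** U = mat 1 \<and> transpose V ** V = mat 1 \<and> (\<forall>i. 0 \<le> s $ i) \<and>
     M = U ** diag s ** transpose V"

text \<open>
  The singular values of a square matrix are unique up to reordering; the choice made here fixes
  some ordering, which is immaterial for the distance. They do not change, up to reordering,
  when \<open>M\<close> is multiplied by orthogonal matrices.
\<close>

definition singular_values :: "real^'k^'k \<Rightarrow> real^'k" where
  "singular_values M = (SOME s. \<exists>U V. compact_svd M U s V)"

text \<open>
  For orthonormal representatives the singular values of \<open>Y\<^sup>T X\<close> lie in \<open>[0,1]\<close>, so \<open>arccos\<close> yields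
  the angles in \<open>[0,\<pi>/2]\<close> whose cosines they are.
\<close>

definition principal_angles :: "real^'k^'n \<Rightarrow> real^'k^'n \<Rightarrow> real^'k" where
  "principal_angles X Y = (\<chi> i. arccos (singular_values (transpose Y ** X) $ i))"

definition gr_dist :: "real^'k^'n \<Rightarrow> real^'k^'n \<Rightarrow> real" where
  "gr_dist X Y = sqrt (\<Sum>i\<in>UNIV. (principal_angles X Y $ i)\<^sup>2)"

text \<open>
  The exponential map at the subspace represented by \<open>X\<close>, for a tangent vector \<open>G\<close> (relative to
  \<open>X\<close>). The resulting subspace is the same for every compact SVD of \<open>G\<close>.
\<close>

definition gr_exp :: "real^'k^'n \<Rightarrow> real^'k^'n \<Rightarrow> (real^'n) set" where
  "gr_exp X G = (SOME S. \<exists>U s V. compact_svd G U s V \<and>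
     S = span (columns (X ** V ** diag (\<chi> i. cos (s $ i)) + U ** diag (\<chi> i. sin (s $ i)))))"

definition objective :: "real^'n^'n \<Rightarrow> real^'k^'n \<Rightarrow> real" where
  "objective A X = - trace (transpose X ** A ** X)"

definition gr_grad :: "real^'n^'n \<Rightarrow> real^'k^'n \<Rightarrow> real^'k^'n" where
  "gr_grad A X = (-2) *\<^sub>R ((mat 1 - X ** transpose X) ** A ** X)"

text \<open>
  Riemannian steepest descent with fixed step size: \<open>S t\<close> are the iterates and \<open>X t\<close> arbitrary
  orthonormal representatives of them.
\<close>

definition steepest_descent ::
    "real^'n^'n \<Rightarrow> real \<Rightarrow> (nat \<Rightarrow> (real^'n) set) \<Rightarrow> (nat \<Rightarrow> real^'k^'n) \<Rightarrow> bool" where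
  "steepest_descent A \<eta> S X \<longleftrightarrow>
     (\<forall>t. represents (X t) (S t)) \<and>
     (\<forall>t. S (Suc t) = gr_exp (X t) (- \<eta> *\<^sub>R gr_grad A (X t)))"

end

theory Submission
  imports Defs
begin

text \<open>
  Write \<open>gap\<close> for \<open>f - f\<^sup>*\<close>, \<open>d\<close> for the initial distance, \<open>a = cos d\<close>, and let \<open>V\<close> represent the
  chosen leading eigenspace. Progress towards \<open>V\<close> is measured not by the Riemannian distance but by
  the overlap \<open>p = \<bar>det (V\<^sup>T X)\<bar>\<close>, the product of the cosines of the principal angles. It is the
  absolute inner product of the unit Pluecker vectors of the two subspaces, so \<open>2 (1 - p)\<close> is a
  squared chordal distance in a Euclidean space and no comparison theorem for geodesic triangles is
  involved. Initially \<open>p \<ge> a\<close> (\<open>overlap_and_dist\<close>), hence \<open>2 (1 - p) \<le> 2 (1 - cos d) \<le> d\<^sup>2\<close>.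

  Let \<open>q\<close> be the squared length of the step \<open>-\<eta> grad f\<close>. One step satisfies four inequalities.

  \<^item> The derivative of \<open>det (V\<^sup>T X)\<close> along the step equals \<open>2 \<eta> gap\<close> times \<open>det (V\<^sup>T X)\<close>, a trace
    identity for eigenvectors (\<open>sum_det_direction\<close>). The second order remainder is at most \<open>q\<close>
    (\<open>plucker_geodesic_remainder\<close>). Therefore the new overlap is at least \<open>(1 + 2 \<eta> gap) p - q\<close>
    (\<open>overlap_step\<close>).

  \<^item> The gap decreases by at least \<open>q / (2 \<eta>)\<close>, since the second derivative of \<open>f\<close> along unit speed
    geodesics is at most \<open>\<gamma>\<close> (\<open>gap_descent\<close>).

  \<^item> \<open>q \<le> 2 \<gamma> \<eta>\<^sup>2 gap\<close>, because a step of size \<open>1 / \<gamma>\<close> cannot make the gap negative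
    (\<open>direction_le_gap\<close>).

  \<^item> \<open>0 \<le> gap \<le> (\<gamma> / 2) \<Sum> sin\<^sup>2 \<theta>\<^sub>i\<close> for the principal angles \<open>\<theta>\<^sub>i\<close> (\<open>gap_bounds\<close>), so initially the
    gap is at most \<open>(\<gamma> / 2) d\<^sup>2\<close>.

  The first and third with \<open>\<eta> \<gamma> \<le> a\<close> show that \<open>p\<close> never decreases, so \<open>p \<ge> a\<close> throughout and
  \<open>2 (1 - p)\<close> drops by at least \<open>4 \<eta> a gap - 2 q\<close> in each step. Together with the second, the quantity
  \<open>4 \<eta> (a t + 1) gap + 2 (1 - p)\<close> does not increase with \<open>t\<close> (\<open>lyapunov_decrease\<close>). Its initial value is
  at most \<open>(2 \<gamma> \<eta> + 1) d\<^sup>2\<close>, and dividing by \<open>4 \<eta> (a t + 1)\<close> gives the stated bound.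

  The eigenvalues are given through the characteristic polynomial, so a spectral theorem and a count of
  multiplicities are needed to see that the complement of the leading eigenspace has Rayleigh quotients
  at most \<open>\<lambda>\<^sub>k\<close> (\<open>leading_frame_exists\<close>). Subspaces are handled through orthonormal families, the columns
  of their representatives.
\<close>

section \<open>Orthonormal families, eigenbases and singular value decompositions\<close>

definition orthonormal_on :: "'i set \<Rightarrow> ('i \<Rightarrow> 'a::real_inner) \<Rightarrow> bool" where
  "orthonormal_on J w \<longleftrightarrow> (\<forall>i\<in>J. \<forall>j\<in>J. w i \<bullet> w j = (if i = j then 1 else 0))"

abbreviation orthonormal :: "('i \<Rightarrow> 'a::real_inner) \<Rightarrow> bool" where
  "orthonormal \<equiv> orthonormal_on UNIV"

lemma orthonormal_inner: "orthonormal w \<Longrightarrow> w i \<bullet> w j = (if i = j then 1 else 0)"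
  by (simp add: orthonormal_on_def)

lemma orthonormal_insertI:
  assumes "orthonormal_on J w" "i \<notin> J" "x \<bullet> x = 1" "\<And>j. j \<in> J \<Longrightarrow> x \<bullet> w j = 0"
  shows "orthonormal_on (insert i J) (w(i := x))"
  using assms by (auto simp: orthonormal_on_def inner_commute)

text \<open>
  One vector is added at a time. The property \<open>Q\<close> is carried along because for eigenvectors the next
  vector exists only if the vectors chosen so far are eigenvectors too; for a plain extension \<open>Q\<close> is
  taken to be trivial.
\<close>

lemma orthonormal_on_extend:
  fixes u :: "'i::finite \<Rightarrow> 'a::real_inner"
  assumes step: "\<And>(J :: 'i set) w. J \<noteq> UNIV \<Longrightarrow> orthonormal_on J w \<Longrightarrow> (\<forall>i\<in>J. Q (w i)) \<Longrightarrow>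
      \<exists>x. x \<bullet> x = 1 \<and> (\<forall>j\<in>J. x \<bullet> w j = 0) \<and> Q x"
    and "orthonormal_on I u" "\<forall>i\<in>I. Q (u i)"
  shows "\<exists>w. (\<forall>i\<in>I. w i = u i) \<and> orthonormal w \<and> (\<forall>i. Q (w i))"
  using assms(2,3)
proof (induction "card (- I)" arbitrary: I u)
  case 0
  then have "I = UNIV" by auto
  with 0 show ?case by (intro exI[of _ u]) auto
next
  case (Suc m)
  then have "I \<noteq> UNIV" by auto
  then obtain i where i: "i \<notin> I" by auto
  from step[OF \<open>I \<noteq> UNIV\<close> Suc.prems] obtain x where
    x: "x \<bullet> x = 1" "\<forall>j\<in>I. x \<bullet> u j = 0" "Q x" by (elim exE conjE)
  have "orthonormal_on (insert i I) (u(i := x))"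
    using orthonormal_insertI[OF Suc.prems(1) i] x by simp
  moreover have "\<forall>j\<in>insert i I. Q ((u(i := x)) j)" using Suc.prems x by auto
  moreover have "m = card (- insert i I)" using Suc.hyps(2) i by (simp add: Compl_insert)
  ultimately obtain w where "\<forall>j\<in>insert i I. w j = (u(i := x)) j" "orthonormal w" "\<forall>i. Q (w i)"
    using Suc.hyps(1)[of "insert i I" "u(i := x)"] by auto
  then show ?case using i by (intro exI[of _ w]) auto
qed

lemma exists_unit_orthogonal:
  fixes w :: "'i::finite \<Rightarrow> 'a::euclidean_space"
  assumes "card J < DIM('a)"
  shows "\<exists>x. x \<bullet> x = 1 \<and> (\<forall>j\<in>J. x \<bullet> w j = 0)"
proof -
  have "dim (w ` J) \<le> card (w ` J)" by (simp add: dim_le_card')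
  then have "dim (w ` J) < DIM('a)"
    using assms card_image_le[of J w] by simp
  then obtain y where y: "y \<noteq> 0" "\<And>z. z \<in> span (w ` J) \<Longrightarrow> orthogonal y z"
    using orthogonal_to_subspace_exists by blast
  let ?x = "y /\<^sub>R norm y"
  have "?x \<bullet> ?x = 1" using y(1) by (simp add: dot_square_norm power2_eq_square)
  moreover have "\<forall>j\<in>J. ?x \<bullet> w j = 0"
    using y(2) by (simp add: orthogonal_def span_base)
  ultimately show ?thesis by blast
qed

lemma symmetric_inner:
  fixes A :: "real^'n^'n"
  assumes "transpose A = A"
  shows "x \<bullet> (A *v y) = (A *v x) \<bullet> y"
  using dot_lmul_matrix[of x A y] transpose_matrix_vector[of A x] assms by simp

text \<open>
  The orthogonal complement of a set of eigenvectors is invariant under a symmetric \<open>A\<close>, so the Rayleigh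
  quotient can be maximised there. A maximiser \<open>x\<close> with value \<open>m\<close> is an eigenvector: moving from \<open>x\<close> along
  \<open>z = A x - m x\<close> would otherwise increase the quotient at first order.
\<close>

lemma exists_unit_eigenvector_orthogonal:
  fixes A :: "real^'n^'n" and w :: "'i::finite \<Rightarrow> real^'n"
  assumes sym: "transpose A = A" and J: "card J < CARD('n)"
    and eig: "\<forall>j\<in>J. \<exists>d. A *v w j = d *\<^sub>R w j"
  shows "\<exists>x. x \<bullet> x = 1 \<and> (\<forall>j\<in>J. x \<bullet> w j = 0) \<and> (\<exists>d. A *v x = d *\<^sub>R x)"
proof -
  define K where "K = sphere 0 1 \<inter> (\<Inter>j\<in>J. {x. w j \<bullet> x = 0})"
  have "compact K" unfolding K_def
    by (intro compact_Int_closed closed_INT) (auto intro: closed_hyperplane)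
  moreover have "K \<noteq> {}"
  proof -
    obtain x where "x \<bullet> x = 1" "\<forall>j\<in>J. x \<bullet> w j = 0"
      using exists_unit_orthogonal[of J w] J by auto
    then have "x \<in> K" by (simp add: K_def norm_eq_1 inner_commute)
    then show ?thesis by blast
  qed
  moreover have "continuous_on K (\<lambda>x. x \<bullet> (A *v x))"
    by (intro continuous_intros linear_continuous_on linear_linear[THEN iffD2]) auto
  ultimately obtain x where x: "x \<in> K" and max: "\<And>y. y \<in> K \<Longrightarrow> y \<bullet> (A *v y) \<le> x \<bullet> (A *v x)"
    using continuous_attains_sup[of K] by blast
  define m where "m = x \<bullet> (A *v x)"
  have xx: "x \<bullet> x = 1" and xw: "\<And>j. j \<in> J \<Longrightarrow> x \<bullet> w j = 0"
    using x by (auto simp: K_def norm_eq_1 inner_commute)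
  have bound: "y \<bullet> (A *v y) \<le> m * (y \<bullet> y)" if y: "\<And>j. j \<in> J \<Longrightarrow> y \<bullet> w j = 0" for y
  proof (cases "y = 0")
    case True
    then show ?thesis by simp
  next
    case False
    have "y /\<^sub>R norm y \<in> K" using False y by (simp add: K_def inner_commute)
    from max[OF this] have "inverse (norm y) * (inverse (norm y) * (y \<bullet> (A *v y))) \<le> m"
      by (simp add: m_def matrix_vector_mult_scaleR)
    then have "(y \<bullet> (A *v y)) / (norm y)\<^sup>2 \<le> m"
      by (simp add: power2_eq_square divide_inverse mult_ac)
    then show ?thesis using False by (simp add: pos_divide_le_eq dot_square_norm)
  qed
  \<comment> \<open>The direction in which the Rayleigh quotient would increase if it were nonzero.\<close>
  define z where "z = A *v x - m *\<^sub>R x"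
  have zw: "z \<bullet> w j = 0" if "j \<in> J" for j
  proof -
    from eig[rule_format, OF that] obtain d where "A *v w j = d *\<^sub>R w j" ..
    then show ?thesis using xw[OF that] symmetric_inner[OF sym, of x "w j"]
      by (simp add: z_def inner_diff_left)
  qed
  define F where "F = m * (z \<bullet> z) - z \<bullet> (A *v z)"
  have "x \<bullet> z = 0" using xx by (simp add: z_def inner_diff_right m_def)
  then have zx: "z \<bullet> x = 0" by (simp add: inner_commute)
  have Ax: "A *v x = z + m *\<^sub>R x" by (simp add: z_def)
  have quad: "2 * (z \<bullet> z) \<le> t * F" if t: "t > 0" for t
  proof -
    have "(x + t *\<^sub>R z) \<bullet> (A *v (x + t *\<^sub>R z)) \<le> m * ((x + t *\<^sub>R z) \<bullet> (x + t *\<^sub>R z))"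
      by (rule bound) (simp add: inner_add_left xw zw)
    moreover have "x \<bullet> (A *v z) = z \<bullet> z"
      using symmetric_inner[OF sym, of x z] zx
      by (simp add: Ax inner_add_left inner_commute[of x z])
    ultimately have "t * (2 * (z \<bullet> z)) \<le> t * (t * F)"
      using zx xx by (simp add: Ax matrix_vector_right_distrib matrix_vector_mult_scaleR
          inner_add_left inner_add_right inner_commute F_def algebra_simps)
    then show ?thesis using t by simp
  qed
  \<comment> \<open>Letting \<open>t\<close> tend to zero leaves no room for a nonzero \<open>z\<close>.\<close>
  have "\<forall>\<^sub>F t in at_right 0. 2 * (z \<bullet> z) \<le> t * F"
    using eventually_at_right_less[of "0::real"] by (rule eventually_mono) (rule quad)
  moreover have "((\<lambda>t. t * F) \<longlongrightarrow> 0 * F) (at_right 0)" by (intro tendsto_intros)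
  ultimately have "2 * (z \<bullet> z) \<le> 0 * F"
    using tendsto_lowerbound trivial_limit_at_right_real by blast
  then have "z \<bullet> z = 0" using inner_ge_zero[of z] by linarith
  then have "z = 0" by simp
  then have "A *v x = m *\<^sub>R x" by (simp add: z_def)
  then have "\<exists>d. A *v x = d *\<^sub>R x" ..
  with xx xw show ?thesis by (intro exI[of _ x] conjI ballI)
qed

theorem symmetric_eigenbasis_extend:
  fixes A :: "real^'n^'n" and u :: "'n \<Rightarrow> real^'n"
  assumes sym: "transpose A = A" and "orthonormal_on I u" "\<forall>i\<in>I. \<exists>d. A *v u i = d *\<^sub>R u i"
  shows "\<exists>w d. (\<forall>i\<in>I. w i = u i) \<and> orthonormal w \<and> (\<forall>i. A *v w i = d i *\<^sub>R w i)"
proof -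
  have "\<exists>w. (\<forall>i\<in>I. w i = u i) \<and> orthonormal w \<and> (\<forall>i. \<exists>d. A *v w i = d *\<^sub>R w i)"
  proof (rule orthonormal_on_extend[where Q = "\<lambda>x. \<exists>d. A *v x = d *\<^sub>R x", OF _ assms(2,3)])
    fix J :: "'n set" and w :: "'n \<Rightarrow> real^'n"
    assume J: "J \<noteq> UNIV" and eig: "\<forall>j\<in>J. \<exists>d. A *v w j = d *\<^sub>R w j"
    have "card J < CARD('n)" using J by (intro psubset_card_mono) auto
    then show "\<exists>x. x \<bullet> x = 1 \<and> (\<forall>j\<in>J. x \<bullet> w j = 0) \<and> (\<exists>d. A *v x = d *\<^sub>R x)"
      by (rule exists_unit_eigenvector_orthogonal[OF sym _ eig])
  qed
  then obtain w where w: "\<forall>i\<in>I. w i = u i" "orthonormal w"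
    and ev: "\<forall>i. \<exists>d. A *v w i = d *\<^sub>R w i" by (elim exE conjE)
  from ev[THEN choice] obtain d where "\<forall>i. A *v w i = d i *\<^sub>R w i" ..
  with w show ?thesis by (intro exI[of _ w] exI[of _ d] conjI)
qed

lemma transpose_mult_eq_inner_columns:
  fixes X :: "real^'k^'n" and Y :: "real^'l^'n"
  shows "transpose X ** Y = (\<chi> i j. column i X \<bullet> column j Y)"
  by (simp add: vec_eq_iff matrix_matrix_mult_def transpose_def column_def inner_vec_def)

lemma orthonormal_columns_iff:
  fixes X :: "real^'k^'n"
  shows "transpose X ** X = mat 1 \<longleftrightarrow> orthonormal (\<lambda>j. column j X)"
  by (auto simp: transpose_mult_eq_inner_columns vec_eq_iff mat_def orthonormal_on_def)

lemma column_of_columns [simp]: "column j (\<chi> i j. x j $ i) = x j"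
  by (simp add: column_def vec_eq_iff)

lemma column_mult: "column j (X ** Y) = X *v column j Y"
  by (simp add: column_def vec_eq_iff matrix_matrix_mult_def matrix_vector_mult_def)

lemma column_mult_diag: "column j (X ** diag s) = (s $ j) *\<^sub>R column j X"
  by (simp add: vec_eq_iff column_def matrix_matrix_mult_def diag_def if_distrib cong: if_cong)

text \<open>
  The right singular vectors are an eigenbasis \<open>w\<close> of \<open>M\<^sup>T M\<close>. The vectors \<open>M w\<^sub>i\<close> are orthogonal;
  the nonzero ones, normalised, are left singular vectors, and the remaining left singular vectors
  are an arbitrary orthonormal completion, for which there is room when \<open>M\<close> has at least as many rows
  as columns.
\<close>

theorem compact_svd_exists:
  fixes M :: "real^'k^'m"
  assumes "CARD('k) \<le> CARD('m)"
  shows "\<exists>U s V. compact_svd M U s V"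
proof -
  have "transpose (transpose M ** M) = transpose M ** M"
    by (simp add: matrix_transpose_mul)
  from symmetric_eigenbasis_extend[OF this, of "{}" "\<lambda>_. 0"]
  obtain w :: "'k \<Rightarrow> real^'k" and d where w: "orthonormal w" and eig: "\<And>i. (transpose M ** M) *v w i = d i *\<^sub>R w i"
    by (auto simp: orthonormal_on_def[of "{}"])
  have Mw: "(M *v w i) \<bullet> (M *v w j) = (if i = j then d i else 0)" for i j
  proof -
    have "(M *v w i) \<bullet> (M *v w j) = ((transpose M ** M) *v w i) \<bullet> w j"
      by (simp add: matrix_vector_mul_assoc[symmetric] transpose_matrix_vector dot_lmul_matrix)
    then show ?thesis using orthonormal_inner[OF w] by (simp add: eig)
  qed
  define s :: "real^'k" where "s = (\<chi> i. norm (M *v w i))"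
  have d: "d i = (s $ i)\<^sup>2" for i using Mw[of i i] by (simp add: s_def dot_square_norm)
  have "orthonormal_on {i. s $ i \<noteq> 0} (\<lambda>i. (M *v w i) /\<^sub>R s $ i)"
    by (simp add: orthonormal_on_def Mw d power2_eq_square divide_simps)
  then have "\<exists>u :: 'k \<Rightarrow> real^'m. (\<forall>i\<in>{i. s $ i \<noteq> 0}. u i = (M *v w i) /\<^sub>R s $ i) \<and> orthonormal u \<and>
      (\<forall>i::'k. True)"
  proof (rule orthonormal_on_extend[where Q = "\<lambda>_. True", rotated])
    fix J :: "'k set" and v :: "'k \<Rightarrow> real^'m"
    assume "J \<noteq> UNIV"
    then have "card J < CARD('k)" by (intro psubset_card_mono) auto
    then have "card J < DIM(real^'m)" using assms by simp
    then show "\<exists>x. x \<bullet> x = 1 \<and> (\<forall>j\<in>J. x \<bullet> v j = 0) \<and> True"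
      by (simp add: exists_unit_orthogonal)
  qed simp
  then obtain u :: "'k \<Rightarrow> real^'m" where u: "\<And>i. s $ i \<noteq> 0 \<Longrightarrow> u i = (M *v w i) /\<^sub>R s $ i" and on: "orthonormal u"
    by auto
  define U :: "real^'k^'m" where "U = (\<chi> i j. u j $ i)"
  define W :: "real^'k^'k" where "W = (\<chi> i j. w j $ i)"
  have WW: "transpose W ** W = mat 1" using w by (simp add: orthonormal_columns_iff W_def)
  have Mu: "M *v w j = (s $ j) *\<^sub>R u j" for j
    using u[of j] by (cases "s $ j = 0") (auto simp: s_def)
  have "M ** W = U ** diag s"
  proof -
    have "column j (M ** W) = (s $ j) *\<^sub>R u j" for j by (simp add: column_mult W_def Mu)
    moreover have "column j (U ** diag s) = (s $ j) *\<^sub>R u j" for j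
      by (simp add: column_mult_diag U_def)
    ultimately have "column j (M ** W) = column j (U ** diag s)" for j by simp
    then show ?thesis by (simp add: vec_eq_iff column_def)
  qed
  then have "M = U ** diag s ** transpose W"
    by (metis WW matrix_left_right_inverse matrix_mul_assoc matrix_mul_rid)
  then have "compact_svd M U s W"
    using WW on by (simp add: compact_svd_def orthonormal_columns_iff U_def s_def)
  then show ?thesis by blast
qed

section \<open>Gram determinants and Pluecker coordinates\<close>

text \<open>
  For families of vectors that are the columns of \<open>V\<close> and \<open>X\<close>, this is the matrix \<open>V\<^sup>T X\<close>.
\<close>

definition gram :: "('k \<Rightarrow> 'a::real_inner) \<Rightarrow> ('k \<Rightarrow> 'a) \<Rightarrow> real^'k^'k" where
  "gram v x = (\<chi> i j. v i \<bullet> x j)"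

text \<open>
  The Pluecker coordinates of \<open>x\<^sub>1 \<and> \<dots> \<and> x\<^sub>k\<close>: the \<open>k \<times> k\<close> minors of the matrix with columns
  \<open>x\<close>. Rows are selected by all maps \<open>f\<close> rather than by \<open>k\<close>-element sets; maps that are not injective
  contribute zero and every set is counted \<open>k!\<close> times, which the normalisation compensates.
\<close>

definition plucker :: "('k::finite \<Rightarrow> real^'n) \<Rightarrow> real^('k \<Rightarrow> 'n)" where
  "plucker x = (1 / sqrt (fact CARD('k))) *\<^sub>R (\<chi> f. det (\<chi> i j. x j $ f i))"

lemma gram_nth [simp]: "gram v x $ i $ j = v i \<bullet> x j"
  by (simp add: gram_def)

lemma gram_transpose: "transpose (gram v x) = gram x v"
  by (simp add: gram_def transpose_def vec_eq_iff inner_commute)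

lemma det_gram_commute: "det (gram v x) = det (gram x v)"
  by (metis det_transpose gram_transpose)

lemma gram_orthonormal: "orthonormal x \<longleftrightarrow> gram x x = mat 1"
  by (auto simp: orthonormal_on_def gram_def mat_def vec_eq_iff)

text \<open>
  The Cauchy--Binet formula. Both minors are expanded by the Leibniz formula, and the sum over row
  selections factorises into entries of the Gram matrix. It turns the determinants of overlaps into
  inner products, so that the Cauchy--Schwarz inequality applies to linear combinations of them.
\<close>

theorem inner_plucker:
  fixes a b :: "'k::finite \<Rightarrow> real^'n"
  shows "plucker a \<bullet> plucker b = det (gram a b)"
proof -
  let ?P = "{\<sigma>::'k \<Rightarrow> 'k. \<sigma> permutes UNIV}"
  have leibniz: "det (\<chi> i j. x j $ f i) = (\<Sum>\<sigma>\<in>?P. of_int (sign \<sigma>) * (\<Prod>i\<in>UNIV. x (\<sigma> i) $ f i))"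
    for x :: "'k \<Rightarrow> real^'n" and f
    by (simp add: det_def)
  have distrib: "(\<Sum>f\<in>UNIV. \<Prod>i\<in>UNIV. a (\<sigma> i) $ f i * b (\<tau> i) $ f i) = (\<Prod>i\<in>UNIV. a (\<sigma> i) \<bullet> b (\<tau> i))"
    for \<sigma> \<tau> :: "'k \<Rightarrow> 'k"
    using prod_sum_PiE[of "UNIV :: 'k set" "\<lambda>_. UNIV :: 'n set" "\<lambda>i l. a (\<sigma> i) $ l * b (\<tau> i) $ l"]
    by (simp add: inner_vec_def)
  have "(\<Sum>f\<in>UNIV. det (\<chi> i j. a j $ f i) * det (\<chi> i j. b j $ f i))
      = (\<Sum>f\<in>UNIV. \<Sum>\<sigma>\<in>?P. \<Sum>\<tau>\<in>?P. of_int (sign \<sigma>) * (of_int (sign \<tau>) *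
          (\<Prod>i\<in>UNIV. a (\<sigma> i) $ f i * b (\<tau> i) $ f i)))"
    by (simp add: leibniz sum_product prod.distrib mult_ac)
  also have "\<dots> = (\<Sum>\<sigma>\<in>?P. \<Sum>f\<in>UNIV. \<Sum>\<tau>\<in>?P. of_int (sign \<sigma>) * (of_int (sign \<tau>) *
          (\<Prod>i\<in>UNIV. a (\<sigma> i) $ f i * b (\<tau> i) $ f i)))"
    by (rule sum.swap)
  also have "\<dots> = (\<Sum>\<sigma>\<in>?P. \<Sum>\<tau>\<in>?P. \<Sum>f\<in>UNIV. of_int (sign \<sigma>) * (of_int (sign \<tau>) *
          (\<Prod>i\<in>UNIV. a (\<sigma> i) $ f i * b (\<tau> i) $ f i)))"
    by (intro sum.cong refl sum.swap)
  also have "\<dots> = (\<Sum>\<sigma>\<in>?P. of_int (sign \<sigma>) * (\<Sum>\<tau>\<in>?P. of_int (sign \<tau>) *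
          (\<Prod>i\<in>UNIV. gram a b $ \<sigma> i $ \<tau> i)))"
    by (simp add: sum_distrib_left[symmetric] distrib)
  also have "\<dots> = (\<Sum>\<sigma>\<in>?P. of_int (sign \<sigma>) * det (\<chi> i. gram a b $ \<sigma> i))"
    by (simp add: det_def)
  also have "\<dots> = (\<Sum>\<sigma>\<in>?P. det (gram a b))"
  proof (rule sum.cong[OF refl])
    fix \<sigma> :: "'k \<Rightarrow> 'k" assume "\<sigma> \<in> ?P"
    then have "det (\<chi> i. gram a b $ \<sigma> i) = of_int (sign \<sigma>) * det (gram a b)"
      by (intro det_permute_rows) simp
    moreover have "(of_int (sign \<sigma>) * of_int (sign \<sigma>) :: real) = 1"
      by (simp flip: of_int_mult)
    ultimately show "of_int (sign \<sigma>) * det (\<chi> i. gram a b $ \<sigma> i) = det (gram a b)"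
      by (simp flip: mult.assoc)
  qed
  also have "\<dots> = fact CARD('k) * det (gram a b)"
    by (simp add: card_permutations)
  finally have "(\<Sum>f\<in>UNIV. det (\<chi> i j. a j $ f i) * det (\<chi> i j. b j $ f i)) = fact CARD('k) * det (gram a b)" .
  then show ?thesis
    by (simp add: plucker_def inner_vec_def[of "vec_lambda _"] flip: real_sqrt_mult)
qed

lemma norm_plucker_orthonormal: "orthonormal x \<Longrightarrow> norm (plucker x) = 1"
  by (simp add: norm_eq_1 inner_plucker gram_orthonormal)

lemma det_gram_le_1:
  fixes v x :: "'k::finite \<Rightarrow> real^'n"
  assumes "orthonormal v" "orthonormal x"
  shows "\<bar>det (gram v x)\<bar> \<le> 1"
  using Cauchy_Schwarz_ineq2[of "plucker v" "plucker x"] assms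
  by (simp add: inner_plucker norm_plucker_orthonormal)

lemma gram_fun_upd:
  "gram (x(i := y)) v = (\<chi> l. if l = i then (\<chi> j. y \<bullet> v j) else (\<chi> j. x l \<bullet> v j))"
  by (simp add: gram_def vec_eq_iff)

lemma linear_det_gram_fun_upd: "linear (\<lambda>y. det (gram v (x(i := y))))"
proof (rule linearI)
  fix y z
  have "(\<chi> j. (y + z) \<bullet> v j) = (\<chi> j. y \<bullet> v j) + (\<chi> j. z \<bullet> v j)"
    by (simp add: vec_eq_iff inner_add_left)
  then show "det (gram v (x(i := y + z))) = det (gram v (x(i := y))) + det (gram v (x(i := z)))"
    using det_row_add[of i "\<lambda>_. \<chi> j. y \<bullet> v j" "\<lambda>_. \<chi> j. z \<bullet> v j" "\<lambda>l. \<chi> j. x l \<bullet> v j"]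
    unfolding det_gram_commute[of v] gram_fun_upd by (simp only:)
next
  fix c :: real and y
  have "(\<chi> j. (c *\<^sub>R y) \<bullet> v j) = c *s (\<chi> j. y \<bullet> v j)"
    by (simp add: vec_eq_iff)
  then show "det (gram v (x(i := c *\<^sub>R y))) = c *\<^sub>R det (gram v (x(i := y)))"
    using det_row_mul[of i c "\<lambda>_. \<chi> j. y \<bullet> v j" "\<lambda>l. \<chi> j. x l \<bullet> v j"]
    unfolding det_gram_commute[of v] gram_fun_upd real_scaleR_def by (simp only:)
qed

lemma det_gram_fun_upd_other:
  assumes "j \<noteq> i"
  shows "det (gram v (x(i := x j))) = 0"
  by (rule det_identical_columns[OF assms]) (simp add: column_def)

lemma det_gram_fun_upd_sum:
  fixes x :: "'k::finite \<Rightarrow> 'a::real_inner"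
  shows "det (gram v (x(i := \<Sum>j\<in>UNIV. c j *\<^sub>R x j))) = c i * det (gram v x)"
proof -
  have "det (gram v (x(i := \<Sum>j\<in>UNIV. c j *\<^sub>R x j))) = (\<Sum>j\<in>UNIV. c j * det (gram v (x(i := x j))))"
    by (simp add: linear_sum[OF linear_det_gram_fun_upd] linear_scale[OF linear_det_gram_fun_upd])
  also have "\<dots> = (\<Sum>j\<in>UNIV. if j = i then c j * det (gram v x) else 0)"
    by (intro sum.cong refl) (simp add: det_gram_fun_upd_other)
  finally show ?thesis by simp
qed

text \<open>
  In a Leibniz term of the \<open>i\<close>-th determinant, moving \<open>A\<close> onto the eigenvectors \<open>v\<close> produces the single
  factor \<open>\<mu> l\<close> for the row \<open>l\<close> that is matched with column \<open>i\<close>. Summing over \<open>i\<close> visits every row exactly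
  once, whatever the permutation. This is the derivative of \<open>det (V\<^sup>T X)\<close> in the direction \<open>A X\<close>.
\<close>

lemma sum_det_gram_fun_upd_eigen:
  fixes A :: "real^'n^'n" and v x :: "'k::finite \<Rightarrow> real^'n"
  assumes sym: "transpose A = A" and eig: "\<And>l. A *v v l = \<mu> l *\<^sub>R v l"
  shows "(\<Sum>i\<in>UNIV. det (gram v (x(i := A *v x i)))) = (\<Sum>l\<in>UNIV. \<mu> l) * det (gram v x)"
proof -
  let ?P = "{\<sigma>::'k \<Rightarrow> 'k. \<sigma> permutes UNIV}"
  have entry: "v l \<bullet> (x(i := A *v x i)) m = (if m = i then \<mu> l else 1) * (v l \<bullet> x m)" for l i m
    using symmetric_inner[OF sym, of "v l" "x i"] by (simp add: eig)
  have "(\<Sum>i\<in>UNIV. det (gram v (x(i := A *v x i)))) =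
     (\<Sum>i\<in>UNIV. \<Sum>\<sigma>\<in>?P. of_int (sign \<sigma>) *
        ((\<Prod>l\<in>UNIV. if \<sigma> l = i then \<mu> l else 1) * (\<Prod>l\<in>UNIV. v l \<bullet> x (\<sigma> l))))"
    by (simp add: det_def entry prod.distrib del: fun_upd_apply)
  also have "\<dots> = (\<Sum>\<sigma>\<in>?P. \<Sum>i\<in>UNIV. of_int (sign \<sigma>) *
        ((\<Prod>l\<in>UNIV. if \<sigma> l = i then \<mu> l else 1) * (\<Prod>l\<in>UNIV. v l \<bullet> x (\<sigma> l))))"
    by (rule sum.swap)
  also have "\<dots> = (\<Sum>\<sigma>\<in>?P. of_int (sign \<sigma>) * ((\<Sum>l\<in>UNIV. \<mu> l) * (\<Prod>l\<in>UNIV. v l \<bullet> x (\<sigma> l))))"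
  proof (rule sum.cong[OF refl])
    fix \<sigma> :: "'k \<Rightarrow> 'k" assume "\<sigma> \<in> ?P"
    then have bij: "bij \<sigma>" by (simp add: permutes_bij)
    have "(\<Sum>i\<in>UNIV. \<Prod>l\<in>UNIV. if \<sigma> l = i then \<mu> l else 1) =
        (\<Sum>m\<in>UNIV. \<Prod>l\<in>UNIV. if \<sigma> l = \<sigma> m then \<mu> l else 1)"
      using sum.reindex_bij_betw[OF bij, of "\<lambda>i. \<Prod>l\<in>UNIV. if \<sigma> l = i then \<mu> l else 1"] by simp
    also have "\<dots> = (\<Sum>m\<in>UNIV. \<mu> m)"
      by (simp add: inj_eq[OF bij_is_inj[OF bij]])
    finally show "(\<Sum>i\<in>UNIV. of_int (sign \<sigma>) *
        ((\<Prod>l\<in>UNIV. if \<sigma> l = i then \<mu> l else 1) * (\<Prod>l\<in>UNIV. v l \<bullet> x (\<sigma> l)))) =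
        of_int (sign \<sigma>) * ((\<Sum>l\<in>UNIV. \<mu> l) * (\<Prod>l\<in>UNIV. v l \<bullet> x (\<sigma> l)))"
      by (simp flip: sum_distrib_left sum_distrib_right)
  qed
  also have "\<dots> = (\<Sum>l\<in>UNIV. \<mu> l) * det (gram v x)"
    by (simp add: det_def sum_distrib_left mult_ac)
  finally show ?thesis .
qed

section \<open>Change of orthonormal basis\<close>

lemma orthonormal_expansion:
  fixes x :: "'k::finite \<Rightarrow> 'a::real_inner"
  assumes x: "orthonormal x" and z: "z \<in> span (range x)"
  shows "z = (\<Sum>j\<in>UNIV. (x j \<bullet> z) *\<^sub>R x j)"
  using z
proof (induction rule: span_induct_alt)
  case base
  then show ?case by simp
next
  case (step c a b)
  then obtain i where i: "a = x i" by auto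
  have "(\<Sum>j\<in>UNIV. (x j \<bullet> (c *\<^sub>R a + b)) *\<^sub>R x j) =
      c *\<^sub>R (\<Sum>j\<in>UNIV. (x j \<bullet> x i) *\<^sub>R x j) + (\<Sum>j\<in>UNIV. (x j \<bullet> b) *\<^sub>R x j)"
    by (simp add: i inner_add_right scaleR_add_left sum.distrib scaleR_sum_right)
  also note step(2)[symmetric]
  also have "(\<Sum>j\<in>UNIV. (x j \<bullet> x i) *\<^sub>R x j) = x i"
    by (simp add: orthonormal_inner[OF x] if_distrib[of "\<lambda>c. c *\<^sub>R _"] cong: if_cong)
  finally show ?case by (simp add: i)
qed

text \<open>
  Two orthonormal bases of the same subspace differ by the orthogonal matrix \<open>gram x y\<close>. Hence the
  objective and the absolute overlap determinant depend on the subspace only, and each iterate may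
  be studied in the basis that fits the singular value decomposition of its gradient.
\<close>

context
  fixes x y :: "'k::finite \<Rightarrow> 'a::real_inner"
  assumes x: "orthonormal x" and y: "orthonormal y" and span: "\<And>i. y i \<in> span (range x)"
begin

lemma gram_change_of_frame: "gram v y = gram v x ** gram x y"
proof -
  have "v i \<bullet> y j = (\<Sum>l\<in>UNIV. (v i \<bullet> x l) * (x l \<bullet> y j))" for i j
    by (subst orthonormal_expansion[OF x span[of j]]) (simp add: inner_sum_right mult.commute)
  then show ?thesis by (simp add: vec_eq_iff matrix_matrix_mult_def)
qed

lemma change_of_frame_orthogonal:
  "transpose (gram x y) ** gram x y = mat 1" "gram x y ** transpose (gram x y) = mat 1"
proof -
  show "transpose (gram x y) ** gram x y = mat 1"
    using gram_change_of_frame[of y] y by (simp add: gram_transpose gram_orthonormal)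
  then show "gram x y ** transpose (gram x y) = mat 1"
    using matrix_left_right_inverse by blast
qed

lemma abs_det_gram_change_of_frame: "\<bar>det (gram v y)\<bar> = \<bar>det (gram v x)\<bar>"
proof -
  have "det (gram x y) * det (gram x y) = 1"
    using arg_cong[OF change_of_frame_orthogonal(1), of det] by (simp add: det_mul)
  then have "\<bar>det (gram x y)\<bar> = 1" by (metis abs_mult_self_eq abs_1 abs_square_eq_1 power2_eq_square)
  then show ?thesis by (simp add: gram_change_of_frame[of v] det_mul abs_mult)
qed

lemma sum_bilinear_change_of_frame:
  fixes B :: "'a \<Rightarrow> 'a \<Rightarrow> real"
  assumes B: "bilinear B"
  shows "(\<Sum>i\<in>UNIV. B (y i) (y i)) = (\<Sum>j\<in>UNIV. B (x j) (x j))"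
proof -
  have expand: "B (y i) (y i) = (\<Sum>j\<in>UNIV. \<Sum>l\<in>UNIV. (x j \<bullet> y i) * (x l \<bullet> y i) * B (x j) (x l))" for i
  proof -
    have "B (y i) (y i) = B (\<Sum>j\<in>UNIV. (x j \<bullet> y i) *\<^sub>R x j) (\<Sum>l\<in>UNIV. (x l \<bullet> y i) *\<^sub>R x l)"
      using orthonormal_expansion[OF x span[of i]] by simp
    also have "\<dots> = (\<Sum>j\<in>UNIV. \<Sum>l\<in>UNIV. B ((x j \<bullet> y i) *\<^sub>R x j) ((x l \<bullet> y i) *\<^sub>R x l))"
      by (simp add: bilinear_sum[OF B] sum.cartesian_product case_prod_beta)
    finally show ?thesis
      by (simp add: bilinear_lmul[OF B] bilinear_rmul[OF B] mult_ac)
  qed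
  have QQ: "(\<Sum>i\<in>UNIV. (x j \<bullet> y i) * (x l \<bullet> y i)) = (if j = l then 1 else 0)" for j l
    using arg_cong[OF change_of_frame_orthogonal(2), of "\<lambda>M. M $ j $ l"]
    by (simp add: matrix_matrix_mult_def transpose_def mat_def)
  have "(\<Sum>i\<in>UNIV. B (y i) (y i)) = (\<Sum>j\<in>UNIV. \<Sum>i\<in>UNIV. \<Sum>l\<in>UNIV. (x j \<bullet> y i) * (x l \<bullet> y i) * B (x j) (x l))"
    unfolding expand by (rule sum.swap)
  also have "\<dots> = (\<Sum>j\<in>UNIV. \<Sum>l\<in>UNIV. \<Sum>i\<in>UNIV. (x j \<bullet> y i) * (x l \<bullet> y i) * B (x j) (x l))"
    by (intro sum.cong refl sum.swap)
  also have "\<dots> = (\<Sum>j\<in>UNIV. B (x j) (x j))"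
    by (simp add: QQ flip: sum_distrib_right)
      (simp add: if_distrib[of "\<lambda>c. c * _"] cong: if_cong)
  finally show ?thesis .
qed

end

section \<open>Inequalities between trigonometric functions\<close>

lemma mult_cos_le_sin:
  fixes t :: real
  assumes "0 \<le> t" "t \<le> pi"
  shows "t * cos t \<le> sin t"
proof -
  have "sin 0 - 0 * cos 0 \<le> sin t - t * cos t"
  proof (rule DERIV_nonneg_imp_nondecreasing[OF assms(1)])
    fix z :: real assume "0 \<le> z" "z \<le> t"
    then have "((\<lambda>t. sin t - t * cos t) has_real_derivative z * sin z) (at z)" "0 \<le> z * sin z"
      using assms by (auto intro!: derivative_eq_intros mult_nonneg_nonneg sin_ge_zero)
    then show "\<exists>D. ((\<lambda>t. sin t - t * cos t) has_real_derivative D) (at z) \<and> 0 \<le> D" by blast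
  qed
  then show ?thesis by simp
qed

text \<open>
  \<open>sin t / t\<close> is decreasing on \<open>[0, \<pi>]\<close>; the cleared form includes the argument zero.
\<close>

lemma sin_ratio_antimono:
  fixes a b :: real
  assumes "0 \<le> a" "a \<le> b" "b \<le> pi"
  shows "a * sin b \<le> b * sin a"
proof (cases "a = 0")
  case False
  then have a: "0 < a" using assms by simp
  have "sin b / b \<le> sin a / a"
  proof (rule DERIV_nonpos_imp_nonincreasing[OF assms(2)])
    fix z :: real assume z: "a \<le> z" "z \<le> b"
    have "((\<lambda>t. sin t / t) has_real_derivative (cos z * z - sin z) / (z * z)) (at z)"
      using a z by (auto intro!: derivative_eq_intros)
    moreover have "(cos z * z - sin z) / (z * z) \<le> 0"
      using mult_cos_le_sin[of z] a z assms by (intro divide_nonpos_nonneg) (auto simp: mult.commute)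
    ultimately show "\<exists>D. ((\<lambda>t. sin t / t) has_real_derivative D) (at z) \<and> D \<le> 0" by blast
  qed
  then show ?thesis using a assms by (simp add: divide_simps mult.commute)
qed simp

text \<open>
  With \<open>u = x + y\<close>, \<open>v = \<bar>x - y\<bar>\<close> and \<open>r\<^sup>2 = (u\<^sup>2 + v\<^sup>2) / 2\<close> the claim reads
  \<open>2 cos r \<le> cos u + cos v\<close>, the midpoint convexity of \<open>cos\<close> as a function of the squared argument. It
  follows from the tangent line at \<open>r\<^sup>2\<close>: subtracting that line from the cosine leaves a function that
  decreases up to \<open>r\<close> and increases from \<open>r\<close> to \<open>\<pi>\<close>.
\<close>

lemma cos_sqrt_sum_le_mult_cos:
  fixes x y :: real
  assumes "0 \<le> x" "0 \<le> y" "x\<^sup>2 + y\<^sup>2 \<le> (pi / 2)\<^sup>2"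
  shows "cos (sqrt (x\<^sup>2 + y\<^sup>2)) \<le> cos x * cos y"
proof (cases "x\<^sup>2 + y\<^sup>2 = 0")
  case False
  define r where "r = sqrt (x\<^sup>2 + y\<^sup>2)"
  \<comment> \<open>Minus twice the slope of \<open>cos\<close> at \<open>r\<close> in the squared argument.\<close>
  define c where "c = sin r / r"
  have r2: "r\<^sup>2 = x\<^sup>2 + y\<^sup>2" by (simp add: r_def)
  have r0: "0 < r" using False by (simp add: r_def sum_power2_gt_zero_iff)
  have rpi: "r \<le> pi / 2" using assms(3) unfolding r2[symmetric] by (rule power2_le_imp_le) simp
  have "(x + y)\<^sup>2 + (x - y)\<^sup>2 = 2 * r\<^sup>2"
    unfolding r2 by (simp add: power2_eq_square algebra_simps)
  then have sum: "(x + y)\<^sup>2 + \<bar>x - y\<bar>\<^sup>2 = 2 * r\<^sup>2" by simp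
  have xy: "0 \<le> x * y" using assms by simp
  have "r\<^sup>2 \<le> (x + y)\<^sup>2" using xy unfolding r2 by (simp add: power2_sum)
  then have ru: "r \<le> x + y" by (rule power2_le_imp_le) (use assms in simp)
  have "\<bar>x - y\<bar>\<^sup>2 \<le> r\<^sup>2" using xy unfolding r2 by (simp add: power2_diff)
  then have vr: "\<bar>x - y\<bar> \<le> r" by (rule power2_le_imp_le) (use r0 in simp)
  have "(x + y)\<^sup>2 \<le> 2 * (pi / 2)\<^sup>2" using sum assms(3) r2 zero_le_power2[of "\<bar>x - y\<bar>"] by linarith
  also have "\<dots> \<le> pi\<^sup>2" by (simp add: power2_eq_square)
  finally have upi: "x + y \<le> pi" by (rule power2_le_imp_le) simp
  let ?h = "\<lambda>t. cos t + c * t\<^sup>2 / 2"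
  have deriv: "(?h has_real_derivative c * t - sin t) (at t)" for t
    by (auto intro!: derivative_eq_intros)
  have "?h r \<le> ?h \<bar>x - y\<bar>"
  proof (rule DERIV_nonpos_imp_nonincreasing[OF vr])
    fix t :: real assume "\<bar>x - y\<bar> \<le> t" "t \<le> r"
    then have "t * sin r \<le> r * sin t" using rpi by (intro sin_ratio_antimono) auto
    then have "c * t - sin t \<le> 0" using r0 by (simp add: c_def divide_simps mult.commute)
    then show "\<exists>D. (?h has_real_derivative D) (at t) \<and> D \<le> 0" using deriv by blast
  qed
  moreover have "?h r \<le> ?h (x + y)"
  proof (rule DERIV_nonneg_imp_nondecreasing[OF ru])
    fix t :: real assume "r \<le> t" "t \<le> x + y"
    then have "r * sin t \<le> t * sin r" using r0 upi by (intro sin_ratio_antimono) auto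
    then have "0 \<le> c * t - sin t" using r0 by (simp add: c_def divide_simps mult.commute)
    then show "\<exists>D. (?h has_real_derivative D) (at t) \<and> 0 \<le> D" using deriv by blast
  qed
  ultimately have "2 * cos r + c * r\<^sup>2 \<le> cos (x + y) + cos \<bar>x - y\<bar> + c * ((x + y)\<^sup>2 + \<bar>x - y\<bar>\<^sup>2) / 2"
    by (simp add: algebra_simps add_divide_distrib)
  then have "2 * cos r \<le> cos (x + y) + cos (x - y)"
    unfolding sum by simp
  then show ?thesis by (simp add: cos_add cos_diff r_def)
qed simp

text \<open>
  For principal angles \<open>\<theta>\<close> this compares the product of the cosines, which is the overlap
  determinant, with the cosine of the Riemannian distance.
\<close>

lemma cos_sqrt_sum_le_prod_cos:
  fixes \<theta> :: "'i \<Rightarrow> real"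
  assumes "finite S" "\<And>i. i \<in> S \<Longrightarrow> 0 \<le> \<theta> i" "(\<Sum>i\<in>S. (\<theta> i)\<^sup>2) \<le> (pi / 2)\<^sup>2"
  shows "cos (sqrt (\<Sum>i\<in>S. (\<theta> i)\<^sup>2)) \<le> (\<Prod>i\<in>S. cos (\<theta> i))"
  using assms
proof (induction rule: finite_induct)
  case (insert i S)
  define r where "r = sqrt (\<Sum>i\<in>S. (\<theta> i)\<^sup>2)"
  have r: "r\<^sup>2 = (\<Sum>i\<in>S. (\<theta> i)\<^sup>2)" "0 \<le> r" by (simp_all add: r_def sum_nonneg)
  have le: "(\<theta> i)\<^sup>2 + r\<^sup>2 \<le> (pi / 2)\<^sup>2" using insert.prems(2) insert.hyps by (simp add: r)
  have "(\<theta> i)\<^sup>2 \<le> (pi / 2)\<^sup>2" using le zero_le_power2[of r] by linarith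
  then have "\<theta> i \<le> pi / 2" by (rule power2_le_imp_le) simp
  then have "0 \<le> cos (\<theta> i)" using insert.prems(1)[of i] by (intro cos_ge_zero) auto
  have "cos (sqrt (\<Sum>i\<in>insert i S. (\<theta> i)\<^sup>2)) = cos (sqrt ((\<theta> i)\<^sup>2 + r\<^sup>2))"
    using insert.hyps by (simp add: r)
  also have "\<dots> \<le> cos (\<theta> i) * cos r"
    using insert.prems(1) r le by (intro cos_sqrt_sum_le_mult_cos) auto
  also have "\<dots> \<le> cos (\<theta> i) * (\<Prod>i\<in>S. cos (\<theta> i))"
  proof (rule mult_left_mono)
    have "r\<^sup>2 \<le> (pi / 2)\<^sup>2" using le zero_le_power2[of "\<theta> i"] by linarith
    then show "cos r \<le> (\<Prod>i\<in>S. cos (\<theta> i))"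
      using insert.IH insert.prems(1) unfolding r by (simp add: r_def)
  qed fact
  finally show ?case using insert.hyps by simp
qed simp

lemma cos_ge_quadratic: "1 - t\<^sup>2 / 2 \<le> cos t" for t :: real
proof -
  have "(sin (t / 2))\<^sup>2 \<le> (t / 2)\<^sup>2"
    using abs_sin_x_le_abs_x[of "t / 2"] by (simp only: abs_le_square_iff)
  then show ?thesis using cos_double_sin[of "t / 2"] by (simp add: power_divide)
qed

lemma prod_cos_ge_quadratic:
  fixes s :: "'i \<Rightarrow> real"
  assumes "finite S" "\<And>i. i \<in> S \<Longrightarrow> 0 \<le> cos (s i)"
  shows "1 - (\<Sum>i\<in>S. (s i)\<^sup>2) / 2 \<le> (\<Prod>i\<in>S. cos (s i))"
  using assms
proof (induction rule: finite_induct)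
  case (insert i S)
  let ?P = "\<Prod>i\<in>S. cos (s i)"
  have "?P \<le> 1" using insert.prems by (intro prod_le_1) auto
  then have "0 \<le> (1 - ?P) * (1 - cos (s i))" by (intro mult_nonneg_nonneg) auto
  then have "?P + cos (s i) - 1 \<le> cos (s i) * ?P" by (simp add: algebra_simps)
  moreover have "1 - (\<Sum>i\<in>S. (s i)\<^sup>2) / 2 \<le> ?P" using insert by auto
  ultimately show ?case using insert.hyps cos_ge_quadratic[of "s i"] by (simp add: add_divide_distrib)
qed simp

section \<open>Geodesics in Pluecker coordinates\<close>

text \<open>
  The end point of the geodesic that starts at the span of \<open>x\<close> with tangent vector having columns
  \<open>s\<^sub>i u\<^sub>i\<close>, when \<open>x\<close> and \<open>u\<close> are adapted to the singular value decomposition of that vector.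
\<close>

definition geodesic_point :: "('k \<Rightarrow> 'a::real_vector) \<Rightarrow> ('k \<Rightarrow> 'a) \<Rightarrow> ('k \<Rightarrow> real) \<Rightarrow> 'k \<Rightarrow> 'a" where
  "geodesic_point x u s = (\<lambda>i. cos (s i) *\<^sub>R x i + sin (s i) *\<^sub>R u i)"

text \<open>
  Where \<open>s\<^sub>i = 0\<close>, a left singular vector \<open>u\<^sub>i\<close> need not be tangent, so orthogonality to \<open>x\<close> is only
  available for nonzero singular values; in the remaining cases the factor \<open>sin (s\<^sub>i)\<close> vanishes.
\<close>

lemma orthonormal_geodesic_point:
  assumes x: "orthonormal x" and u: "orthonormal u" and tan: "\<And>i j. s i \<noteq> 0 \<Longrightarrow> x j \<bullet> u i = 0"
  shows "orthonormal (geodesic_point x u s)"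
    and "geodesic_point x u s i \<bullet> x j = (if i = j then cos (s i) else 0)"
    and "s j * (geodesic_point x u s i \<bullet> u j) = (if i = j then s i * sin (s i) else 0)"
proof -
  have 0: "sin (s i) * (x j \<bullet> u i) = 0" "sin (s i) * (u i \<bullet> x j) = 0" "s i * (x j \<bullet> u i) = 0" for i j
    using tan[of i j] by (cases "s i = 0"; simp add: inner_commute)+
  show "geodesic_point x u s i \<bullet> x j = (if i = j then cos (s i) else 0)"
    using 0 by (simp add: geodesic_point_def inner_add_left orthonormal_inner[OF x])
  show "s j * (geodesic_point x u s i \<bullet> u j) = (if i = j then s i * sin (s i) else 0)"
  proof -
    have "s j * (geodesic_point x u s i \<bullet> u j) = cos (s i) * (s j * (x i \<bullet> u j)) + s j * sin (s i) * (u i \<bullet> u j)"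
      by (simp add: geodesic_point_def inner_add_left algebra_simps)
    then show ?thesis by (simp only: 0(3) orthonormal_inner[OF u]) simp
  qed
  show "orthonormal (geodesic_point x u s)"
    unfolding orthonormal_on_def
  proof (intro ballI)
    fix i j
    have "geodesic_point x u s i \<bullet> geodesic_point x u s j =
       cos (s i) * cos (s j) * (x i \<bullet> x j) + sin (s i) * sin (s j) * (u i \<bullet> u j)
       + cos (s i) * (sin (s j) * (x i \<bullet> u j)) + cos (s j) * (sin (s i) * (u i \<bullet> x j))"
      by (simp add: geodesic_point_def inner_add_left inner_add_right algebra_simps)
    then show "geodesic_point x u s i \<bullet> geodesic_point x u s j = (if i = j then 1 else 0)"
      using sin_cos_squared_add[of "s j"] by (simp add: 0 orthonormal_inner[OF x] orthonormal_inner[OF u] power2_eq_square)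
  qed
qed

text \<open>
  The curve of Pluecker vectors agrees with its first order Taylor polynomial up to the squared
  length \<open>q = s\<^sub>1\<^sup>2 + \<dots> + s\<^sub>k\<^sup>2\<close> of the tangent vector. By the Cauchy--Binet formula all inner products
  among the end point, the start point and the derivative vectors \<open>T\<^sub>i\<close> are determinants of diagonal
  or degenerate matrices, so the squared remainder can be computed: with \<open>c\<close> the product of the
  \<open>cos (s\<^sub>i)\<close>, it is at most \<open>2 + q - 2 c (1 + q)\<close>, and \<open>c \<ge> 1 - q / 2\<close> makes this at most \<open>q\<^sup>2\<close>.

  Bounding the second order terms one by one would lose a factor \<open>k\<close>; the orthogonality of the
  Pluecker vectors is what keeps the constant equal to one.
\<close>

theorem plucker_geodesic_remainder:
  fixes x u :: "'k::finite \<Rightarrow> real^'n"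
  assumes x: "orthonormal x" and u: "orthonormal u" and tan: "\<And>i j. s i \<noteq> 0 \<Longrightarrow> x j \<bullet> u i = 0"
    and s: "\<And>i. 0 \<le> s i" "\<And>i. s i \<le> 1"
  shows "norm (plucker (geodesic_point x u s) - plucker x - (\<Sum>i\<in>UNIV. plucker (x(i := s i *\<^sub>R u i))))
     \<le> (\<Sum>i\<in>UNIV. (s i)\<^sup>2)"
proof -
  define y where "y = geodesic_point x u s"
  define T where "T i = plucker (x(i := s i *\<^sub>R u i))" for i
  define q where "q = (\<Sum>i\<in>UNIV. (s i)\<^sup>2)"
  define c where "c = (\<Prod>i\<in>UNIV. cos (s i))"
  have y: "orthonormal y" and yx: "\<And>i j. y i \<bullet> x j = (if i = j then cos (s i) else 0)"
    and yu: "\<And>i j. s j * (y i \<bullet> u j) = (if i = j then s i * sin (s i) else 0)"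
    using orthonormal_geodesic_point[OF x u tan] by (auto simp: y_def)
  have xu: "s i * (x j \<bullet> u i) = 0" "s i * (u i \<bullet> x j) = 0" for i j
    using tan[of i j] by (cases "s i = 0"; simp add: inner_commute)+
  have s_pi: "s i \<le> pi / 2" for i using s(2)[of i] pi_gt3 by linarith
  have cos_pos: "0 \<le> cos (s i)" for i
    using s(1)[of i] s_pi[of i] by (intro cos_ge_zero) auto
  have q0: "0 \<le> q" by (simp add: q_def sum_nonneg)
  have yy: "plucker y \<bullet> plucker y = 1" and xx: "plucker x \<bullet> plucker x = 1"
    using y x by (simp_all add: inner_plucker gram_orthonormal)
  have xy: "plucker y \<bullet> plucker x = c"
    by (simp add: inner_plucker det_diagonal yx c_def)
  have xT: "plucker x \<bullet> T i = 0" for i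
  proof -
    have "column i (gram x (x(i := s i *\<^sub>R u i))) = 0" by (simp add: column_def vec_eq_iff xu)
    then show ?thesis by (simp add: T_def inner_plucker det_zero_column)
  qed
  have TT: "T i \<bullet> T j = (if i = j then (s i)\<^sup>2 else 0)" for i j
  proof (cases "i = j")
    case True
    have "gram (x(i := s i *\<^sub>R u i)) (x(i := s i *\<^sub>R u i)) $ l $ m =
        (if l = m then if l = i then (s i)\<^sup>2 else 1 else 0)" for l m
      using xu[of i l] xu[of i m] by (auto simp: orthonormal_inner[OF x] orthonormal_inner[OF u] power2_eq_square)
    then have "det (gram (x(i := s i *\<^sub>R u i)) (x(i := s i *\<^sub>R u i))) = (\<Prod>l\<in>UNIV. if l = i then (s i)\<^sup>2 else 1)"
      by (subst det_diagonal) (simp_all del: gram_nth)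
    then show ?thesis by (simp add: True T_def inner_plucker)
  next
    case False
    then have "gram (x(i := s i *\<^sub>R u i)) (x(j := s j *\<^sub>R u j)) $ i $ m = 0" for m
      using xu(2)[of i m] by (simp add: orthonormal_inner[OF u])
    then have "row i (gram (x(i := s i *\<^sub>R u i)) (x(j := s j *\<^sub>R u j))) = 0"
      by (simp add: row_def vec_eq_iff del: gram_nth)
    then show ?thesis by (simp add: False T_def inner_plucker det_zero_row)
  qed
  have yT: "(s i)\<^sup>2 * c \<le> plucker y \<bullet> T i" for i
  proof -
    have "s i * (s i * cos (s i)) \<le> s i * sin (s i)"
      using s(1)[of i] s_pi[of i] by (intro mult_left_mono mult_cos_le_sin) auto
    then have i: "(s i)\<^sup>2 * cos (s i) \<le> s i * sin (s i)" by (simp add: power2_eq_square mult.assoc)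
    have "(s i)\<^sup>2 * c = (\<Prod>l\<in>UNIV. (if l = i then (s i)\<^sup>2 else 1) * cos (s l))"
      by (simp add: prod.distrib c_def)
    also have "\<dots> \<le> (\<Prod>l\<in>UNIV. if l = i then s i * sin (s i) else cos (s l))"
      by (rule prod_mono) (simp add: i cos_pos)
    also have "\<dots> = det (gram y (x(i := s i *\<^sub>R u i)))"
      by (subst det_diagonal) (auto simp: yx yu intro!: prod.cong)
    finally show ?thesis by (simp add: T_def inner_plucker)
  qed
  have c: "1 - q / 2 \<le> c" unfolding c_def q_def by (rule prod_cos_ge_quadratic) (auto simp: cos_pos)
  have "(norm (plucker y - plucker x - sum T UNIV))\<^sup>2 =
     2 + sum T UNIV \<bullet> sum T UNIV - 2 * c - 2 * (plucker y \<bullet> sum T UNIV) + 2 * (plucker x \<bullet> sum T UNIV)"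
    unfolding power2_norm_eq_inner
    by (simp add: inner_diff_left inner_diff_right yy xx xy inner_commute[of "plucker x" "plucker y"]
        inner_commute[of "sum T UNIV" "plucker x"] inner_commute[of "sum T UNIV" "plucker y"])
  also have "\<dots> \<le> 2 + q - 2 * c - 2 * (q * c)"
  proof -
    have "sum T UNIV \<bullet> sum T UNIV = q"
      by (simp add: inner_sum_left inner_sum_right TT q_def)
    moreover have "plucker x \<bullet> sum T UNIV = 0" by (simp add: inner_sum_right xT)
    moreover have "q * c \<le> plucker y \<bullet> sum T UNIV"
      by (simp add: inner_sum_right q_def sum_distrib_right sum_mono yT)
    ultimately show ?thesis by simp
  qed
  also have "\<dots> \<le> q\<^sup>2"
    using mult_left_mono[OF c, of "1 + q"] q0
    by (simp add: power2_eq_square algebra_simps add_divide_distrib)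
  finally have "norm (plucker y - plucker x - sum T UNIV) \<le> q"
    using q0 by (rule power2_le_imp_le)
  then show ?thesis by (simp add: y_def T_def q_def)
qed

section \<open>Rayleigh quotients along geodesics\<close>

text \<open>
  The part of \<open>z\<close> that is orthogonal to the span of \<open>b\<close>.
\<close>

lemma residual_inner_self:
  fixes b :: "'k::finite \<Rightarrow> 'a::real_inner"
  assumes b: "orthonormal b"
  defines "r z \<equiv> z - (\<Sum>j\<in>UNIV. (b j \<bullet> z) *\<^sub>R b j)"
  shows "b i \<bullet> r z = 0" and "r z \<bullet> r z = z \<bullet> z - (\<Sum>j\<in>UNIV. (b j \<bullet> z)\<^sup>2)"
proof -
  have orth: "b i \<bullet> r z = 0" for i
    by (simp add: r_def inner_diff_right inner_sum_right orthonormal_inner[OF b]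
        if_distrib[of "\<lambda>c. _ * c"] cong: if_cong)
  then show "b i \<bullet> r z = 0" .
  have "r z \<bullet> r z = z \<bullet> r z - (\<Sum>j\<in>UNIV. (b j \<bullet> z) *\<^sub>R b j) \<bullet> r z"
    by (simp add: r_def inner_diff_left)
  also have "\<dots> = z \<bullet> r z" by (simp add: inner_sum_left orth)
  also have "\<dots> = z \<bullet> z - (\<Sum>j\<in>UNIV. (b j \<bullet> z)\<^sup>2)"
    by (simp add: r_def inner_diff_right inner_sum_right power2_eq_square inner_commute[of z "b _"])
  finally show "r z \<bullet> r z = z \<bullet> z - (\<Sum>j\<in>UNIV. (b j \<bullet> z)\<^sup>2)" .
qed

lemma bessel_le:
  fixes b :: "'k::finite \<Rightarrow> 'a::real_inner"
  assumes "orthonormal b"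
  shows "(\<Sum>j\<in>UNIV. (b j \<bullet> z)\<^sup>2) \<le> z \<bullet> z"
proof -
  have "0 \<le> (z - (\<Sum>j\<in>UNIV. (b j \<bullet> z) *\<^sub>R b j)) \<bullet> (z - (\<Sum>j\<in>UNIV. (b j \<bullet> z) *\<^sub>R b j))"
    by (rule inner_ge_zero)
  then show ?thesis unfolding residual_inner_self(2)[OF assms] by simp
qed

locale bounded_symmetric =
  fixes A :: "real^'n^'n" and lo hi :: real
  assumes sym: "transpose A = A"
    and rayleigh_ge: "\<And>z. lo * (z \<bullet> z) \<le> z \<bullet> (A *v z)"
    and rayleigh_le: "\<And>z. z \<bullet> (A *v z) \<le> hi * (z \<bullet> z)"
begin

lemma form_commute: "b \<bullet> (A *v a) = a \<bullet> (A *v b)"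
  using symmetric_inner[OF sym, of a b] by (simp add: inner_commute)

lemma form_expand:
  "(c *\<^sub>R a + d *\<^sub>R b) \<bullet> (A *v (c *\<^sub>R a + d *\<^sub>R b)) =
    c\<^sup>2 * (a \<bullet> (A *v a)) + 2 * c * d * (a \<bullet> (A *v b)) + d\<^sup>2 * (b \<bullet> (A *v b))"
  using form_commute[of b a]
  by (simp add: matrix_vector_right_distrib matrix_vector_mult_scaleR inner_add_left inner_add_right
      power2_eq_square algebra_simps)

text \<open>
  Polarisation: \<open>4 (a \<bullet> A b)\<close> is the difference of the form at \<open>a + b\<close> and at \<open>a - b\<close>, both of
  squared norm two.
\<close>

lemma off_diagonal_le:
  assumes "a \<bullet> a = 1" "b \<bullet> b = 1" "a \<bullet> b = 0"
  shows "2 * (a \<bullet> (A *v b)) \<le> hi - lo"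
proof -
  have ab: "b \<bullet> a = 0" using assms by (simp add: inner_commute)
  have "a \<bullet> (A *v a) + 2 * (a \<bullet> (A *v b)) + b \<bullet> (A *v b) \<le> hi * 2"
    using rayleigh_le[of "1 *\<^sub>R a + 1 *\<^sub>R b"] unfolding form_expand
    by (simp add: inner_add_left inner_add_right assms ab)
  moreover have "lo * 2 \<le> a \<bullet> (A *v a) - 2 * (a \<bullet> (A *v b)) + b \<bullet> (A *v b)"
    using rayleigh_ge[of "1 *\<^sub>R a + (-1) *\<^sub>R b"] unfolding form_expand
    by (simp add: inner_diff_left inner_diff_right assms ab)
  ultimately show ?thesis by linarith
qed

text \<open>
  Along the great circle \<open>y\<close> from \<open>a\<close> towards \<open>b\<close>, the second derivative of \<open>y \<bullet> A y\<close> is twice the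
  difference of the form at two orthonormal vectors, hence at least \<open>-2 (hi - lo)\<close>. This is the
  smoothness of the objective, one column at a time.
\<close>

lemma form_along_geodesic_ge:
  assumes "a \<bullet> a = 1" "b \<bullet> b = 1" "a \<bullet> b = 0" and t: "0 \<le> t"
  defines "y \<equiv> cos t *\<^sub>R a + sin t *\<^sub>R b"
  shows "a \<bullet> (A *v a) + 2 * t * (a \<bullet> (A *v b)) - (hi - lo) * t\<^sup>2 \<le> y \<bullet> (A *v y)"
proof -
  define \<alpha> \<beta> \<delta> where "\<alpha> = a \<bullet> (A *v a)" and "\<beta> = a \<bullet> (A *v b)" and "\<delta> = b \<bullet> (A *v b)"
  \<comment> \<open>The claim is \<open>k 0 \<le> k t\<close>; the first derivative of \<open>k\<close> vanishes at zero and the second is nonnegative.\<close>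
  define k where "k t = (cos t)\<^sup>2 * \<alpha> + 2 * cos t * sin t * \<beta> + (sin t)\<^sup>2 * \<delta> - 2 * t * \<beta> + (hi - lo) * t\<^sup>2" for t
  define k' where "k' t = sin (2 * t) * (\<delta> - \<alpha>) + 2 * cos (2 * t) * \<beta> - 2 * \<beta> + 2 * (hi - lo) * t" for t
  have ab: "b \<bullet> a = 0" using assms by (simp add: inner_commute)
  have dk: "(k has_real_derivative k' t) (at t)" for t
    unfolding k_def k'_def sin_double cos_double
    by (auto intro!: derivative_eq_intros simp: power2_eq_square algebra_simps)
  have dk': "(k' has_real_derivative 2 * cos (2 * t) * (\<delta> - \<alpha>) - 4 * sin (2 * t) * \<beta> + 2 * (hi - lo)) (at t)" for t
    unfolding k'_def by (auto intro!: derivative_eq_intros simp: algebra_simps)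
  have curvature: "0 \<le> 2 * cos (2 * t) * (\<delta> - \<alpha>) - 4 * sin (2 * t) * \<beta> + 2 * (hi - lo)" for t
  proof -
    define X where "X = cos (2 * t) * (\<delta> - \<alpha>) - 2 * sin (2 * t) * \<beta>"
    let ?y = "cos t *\<^sub>R a + sin t *\<^sub>R b" and ?z = "(- sin t) *\<^sub>R a + cos t *\<^sub>R b"
    have "?y \<bullet> ?y = 1" "?z \<bullet> ?z = 1"
      using sin_cos_squared_add[of t]
      by (simp_all add: inner_add_left inner_add_right inner_diff_left inner_diff_right assms ab power2_eq_square algebra_simps)
    then have "lo \<le> ?z \<bullet> (A *v ?z)" "?y \<bullet> (A *v ?y) \<le> hi"
      using rayleigh_ge[of ?z] rayleigh_le[of ?y] by simp_all
    then have "lo - hi \<le> ?z \<bullet> (A *v ?z) - ?y \<bullet> (A *v ?y)" by linarith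
    also have "\<dots> = cos (2 * t) * (\<delta> - \<alpha>) - 2 * sin (2 * t) * \<beta>"
      unfolding form_expand \<alpha>_def[symmetric] \<beta>_def[symmetric] \<delta>_def[symmetric] sin_double cos_double
      by (simp add: power2_eq_square algebra_simps)
    finally have ge: "lo - hi \<le> X" unfolding X_def .
    have eq: "2 * cos (2 * t) * (\<delta> - \<alpha>) - 4 * sin (2 * t) * \<beta> + 2 * (hi - lo) = 2 * (X - (lo - hi))"
      by (simp add: X_def algebra_simps)
    show ?thesis unfolding eq using ge by simp
  qed
  have k'_nonneg: "0 \<le> k' z" if "0 \<le> z" for z
  proof -
    have "k' 0 \<le> k' z"
      using that by (rule DERIV_nonneg_imp_nondecreasing) (use dk' curvature in blast)
    then show ?thesis by (simp add: k'_def)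
  qed
  have "k 0 \<le> k t"
    using t by (rule DERIV_nonneg_imp_nondecreasing) (use dk k'_nonneg in blast)
  then show ?thesis
    unfolding y_def form_expand by (simp add: k_def \<alpha>_def \<beta>_def \<delta>_def algebra_simps)
qed

end

section \<open>One step of steepest descent\<close>

text \<open>
  The columns \<open>s\<^sub>i u\<^sub>i\<close> are those of \<open>-\<eta> grad f\<close> at the span of \<open>x\<close>, because
  \<open>grad f = -2 (I - X X\<^sup>T) A X\<close>. Thus \<open>x\<close>, \<open>u\<close> and \<open>s\<close> come from a singular value decomposition of the
  step, with the right singular vectors absorbed into the choice of the basis \<open>x\<close>.
\<close>

definition descent_direction ::
    "real^'n^'n \<Rightarrow> real \<Rightarrow> ('k::finite \<Rightarrow> real^'n) \<Rightarrow> ('k \<Rightarrow> real^'n) \<Rightarrow> ('k \<Rightarrow> real) \<Rightarrow> bool" where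
  "descent_direction A \<eta> x u s \<longleftrightarrow>
     orthonormal x \<and> orthonormal u \<and> (\<forall>i. 0 \<le> s i) \<and>
     (\<forall>i. s i *\<^sub>R u i = (2 * \<eta>) *\<^sub>R (A *v x i - (\<Sum>j\<in>UNIV. (x j \<bullet> (A *v x i)) *\<^sub>R x j)))"

text \<open>
  An orthonormal basis \<open>v\<close> of a subspace spanned by leading eigenvectors. The number \<open>mid\<close> separates its
  eigenvalues from the Rayleigh quotients on the orthogonal complement; it may be attained on both
  sides, so a vanishing eigengap is included.
\<close>

locale leading_frame = bounded_symmetric A lo hi
  for A :: "real^'n^'n" and lo hi +
  fixes v :: "'k::finite \<Rightarrow> real^'n" and \<mu> :: "'k \<Rightarrow> real" and mid :: real
  assumes v: "orthonormal v"
    and eig: "\<And>l. A *v v l = \<mu> l *\<^sub>R v l"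
    and \<mu>_ge: "\<And>l. mid \<le> \<mu> l"
    and \<mu>_le: "\<And>l. \<mu> l \<le> hi"
    and complement_le: "\<And>z. (\<And>l. v l \<bullet> z = 0) \<Longrightarrow> z \<bullet> (A *v z) \<le> mid * (z \<bullet> z)"
begin

definition gap :: "('k \<Rightarrow> real^'n) \<Rightarrow> real" where
  "gap x = (\<Sum>l\<in>UNIV. \<mu> l) - (\<Sum>i\<in>UNIV. x i \<bullet> (A *v x i))"

lemma lo_le_hi: "lo \<le> hi"
proof -
  fix l :: 'k
  have "v l \<bullet> v l = 1" using orthonormal_inner[OF v] by simp
  then show ?thesis using rayleigh_ge[of "v l"] rayleigh_le[of "v l"] by simp
qed

text \<open>
  The span of \<open>v\<close> and its complement are both invariant, so the mixed terms vanish.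
\<close>

lemma form_decomposition:
  defines "r z \<equiv> z - (\<Sum>l\<in>UNIV. (v l \<bullet> z) *\<^sub>R v l)"
  shows "z \<bullet> (A *v z) = (\<Sum>l\<in>UNIV. \<mu> l * (v l \<bullet> z)\<^sup>2) + r z \<bullet> (A *v r z)"
proof -
  define w where "w = (\<Sum>l\<in>UNIV. (v l \<bullet> z) *\<^sub>R v l)"
  have orth: "v l \<bullet> r z = 0" for l
    unfolding r_def by (rule residual_inner_self(1)[OF v])
  have Aw: "A *v w = (\<Sum>l\<in>UNIV. (\<mu> l * (v l \<bullet> z)) *\<^sub>R v l)"
    by (simp add: w_def linear_sum[OF matrix_vector_mul_linear] matrix_vector_mult_scaleR eig mult.commute)
  have "r z \<bullet> (A *v w) = 0" by (simp add: Aw inner_sum_right inner_commute[of "r z" "v _"] orth)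
  moreover have "w \<bullet> (A *v w) = (\<Sum>l\<in>UNIV. \<mu> l * (v l \<bullet> z)\<^sup>2)"
    by (simp add: Aw inner_sum_right) (simp add: w_def inner_sum_left orthonormal_inner[OF v]
        if_distrib[of "\<lambda>c. _ * c"] power2_eq_square mult_ac cong: if_cong)
  moreover have "z = 1 *\<^sub>R r z + 1 *\<^sub>R w" by (simp add: r_def w_def)
  ultimately show ?thesis using form_expand[of 1 "r z" 1 w] by simp
qed

text \<open>
  The subspace of \<open>x\<close> misses the mass \<open>e l\<close> of each \<open>v l\<close> and carries the mass \<open>r i\<close> outside the
  span of \<open>v\<close>; both masses have the same total \<open>D\<close>. The gap is the form lost on the first minus the
  form gained on the second. Since \<open>mid\<close> separates the two, the gap is nonnegative, and it is at most
  the full spread \<open>hi - lo\<close> times \<open>D\<close>.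
\<close>

lemma gap_bounds:
  assumes x: "orthonormal x"
  shows "0 \<le> gap x"
    and "gap x \<le> (hi - lo) * (CARD('k) - (\<Sum>i\<in>UNIV. \<Sum>l\<in>UNIV. (v l \<bullet> x i)\<^sup>2))"
proof -
  define r where "r i = x i - (\<Sum>l\<in>UNIV. (v l \<bullet> x i) *\<^sub>R v l)" for i
  define e where "e l = 1 - (\<Sum>i\<in>UNIV. (v l \<bullet> x i)\<^sup>2)" for l
  define D where "D = CARD('k) - (\<Sum>i\<in>UNIV. \<Sum>l\<in>UNIV. (v l \<bullet> x i)\<^sup>2)"
  have e0: "0 \<le> e l" for l
    using bessel_le[OF x, of "v l"] by (simp add: e_def orthonormal_inner[OF v] inner_commute)
  have sum_e: "(\<Sum>l\<in>UNIV. e l) = D"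
    by (simp add: e_def sum_subtractf D_def) (rule sum.swap)
  have rr: "r i \<bullet> r i = 1 - (\<Sum>l\<in>UNIV. (v l \<bullet> x i)\<^sup>2)" for i
    unfolding r_def using residual_inner_self(2)[OF v, of "x i"] by (simp add: orthonormal_inner[OF x])
  have sum_r: "(\<Sum>i\<in>UNIV. r i \<bullet> r i) = D"
    by (simp add: rr sum_subtractf D_def)
  have orth: "v l \<bullet> r i = 0" for l i
    unfolding r_def by (rule residual_inner_self(1)[OF v])
  have "(\<Sum>i\<in>UNIV. x i \<bullet> (A *v x i)) =
      (\<Sum>i\<in>UNIV. \<Sum>l\<in>UNIV. \<mu> l * (v l \<bullet> x i)\<^sup>2) + (\<Sum>i\<in>UNIV. r i \<bullet> (A *v r i))"
    by (subst form_decomposition) (simp add: r_def sum.distrib)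
  also have "(\<Sum>i\<in>UNIV. \<Sum>l\<in>UNIV. \<mu> l * (v l \<bullet> x i)\<^sup>2) = (\<Sum>l\<in>UNIV. \<mu> l * (1 - e l))"
    by (subst sum.swap) (simp add: e_def sum_distrib_left)
  finally have gap: "gap x = (\<Sum>l\<in>UNIV. \<mu> l * e l) - (\<Sum>i\<in>UNIV. r i \<bullet> (A *v r i))"
    by (simp add: gap_def algebra_simps sum_subtractf)
  have "mid * D \<le> (\<Sum>l\<in>UNIV. \<mu> l * e l)"
    unfolding sum_e[symmetric] sum_distrib_left by (intro sum_mono mult_right_mono \<mu>_ge e0)
  moreover have "(\<Sum>i\<in>UNIV. r i \<bullet> (A *v r i)) \<le> mid * D"
    unfolding sum_r[symmetric] sum_distrib_left by (intro sum_mono complement_le orth)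
  ultimately show "0 \<le> gap x" by (simp add: gap)
  have "(\<Sum>l\<in>UNIV. \<mu> l * e l) \<le> hi * D"
    unfolding sum_e[symmetric] sum_distrib_left by (intro sum_mono mult_right_mono \<mu>_le e0)
  moreover have "lo * D \<le> (\<Sum>i\<in>UNIV. r i \<bullet> (A *v r i))"
    unfolding sum_r[symmetric] sum_distrib_left by (intro sum_mono rayleigh_ge)
  ultimately have "gap x \<le> (hi - lo) * D" by (simp add: gap algebra_simps)
  then show "gap x \<le> (hi - lo) * (CARD('k) - (\<Sum>i\<in>UNIV. \<Sum>l\<in>UNIV. (v l \<bullet> x i)\<^sup>2))" by (simp add: D_def)
qed

context
  fixes \<eta> :: real and x u :: "'k \<Rightarrow> real^'n" and s :: "'k \<Rightarrow> real"
  assumes dir: "descent_direction A \<eta> x u s" and \<eta>: "0 < \<eta>" "2 * \<eta> * (hi - lo) \<le> 1"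
begin

lemma x_orthonormal: "orthonormal x" and u_orthonormal: "orthonormal u" and s_nonneg: "0 \<le> s i"
  and direction: "s i *\<^sub>R u i = (2 * \<eta>) *\<^sub>R (A *v x i - (\<Sum>j\<in>UNIV. (x j \<bullet> (A *v x i)) *\<^sub>R x j))"
  using dir by (auto simp: descent_direction_def)

lemma tangent: "s i \<noteq> 0 \<Longrightarrow> x j \<bullet> u i = 0"
proof -
  have "s i * (x j \<bullet> u i) = x j \<bullet> (s i *\<^sub>R u i)" by simp
  also have "\<dots> = 0"
    unfolding direction inner_scaleR_right residual_inner_self(1)[OF x_orthonormal] by simp
  finally show "s i \<noteq> 0 \<Longrightarrow> x j \<bullet> u i = 0" by simp
qed

lemma step_length: "s i \<noteq> 0 \<Longrightarrow> s i = 2 * \<eta> * (x i \<bullet> (A *v u i))"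
proof -
  assume i: "s i \<noteq> 0"
  have "s i = u i \<bullet> (s i *\<^sub>R u i)" by (simp add: orthonormal_inner[OF u_orthonormal])
  also have "\<dots> = 2 * \<eta> * (u i \<bullet> (A *v x i))"
    unfolding direction using tangent[OF i]
    by (simp add: inner_diff_right inner_sum_right inner_commute[of "u i" "x _"])
  finally show ?thesis by (simp add: form_commute[of "u i"])
qed

lemma step_length_le_1: "s i \<le> 1"
proof (cases "s i = 0")
  case False
  have "2 * (x i \<bullet> (A *v u i)) \<le> hi - lo"
    using tangent[OF False]
    by (intro off_diagonal_le) (auto simp: orthonormal_inner[OF x_orthonormal] orthonormal_inner[OF u_orthonormal])
  then have "\<eta> * (2 * (x i \<bullet> (A *v u i))) \<le> \<eta> * (hi - lo)" using \<eta> by (intro mult_left_mono) auto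
  then show ?thesis using step_length[OF False] \<eta> by linarith
qed simp

text \<open>
  The first order gain along the negative gradient is \<open>q / \<eta>\<close> with \<open>q\<close> the squared length of the step,
  and for a step size of at most the inverse of the smoothness constant \<open>2 (hi - lo)\<close>, curvature takes
  back at most half of it.
\<close>

lemma gap_descent: "gap (geodesic_point x u s) \<le> gap x - (\<Sum>i\<in>UNIV. (s i)\<^sup>2) / (2 * \<eta>)"
proof -
  let ?y = "geodesic_point x u s"
  have "x i \<bullet> (A *v x i) + (s i)\<^sup>2 / (2 * \<eta>) \<le> ?y i \<bullet> (A *v ?y i)" for i
  proof (cases "s i = 0")
    case False
    have "(hi - lo) * (s i)\<^sup>2 \<le> (s i)\<^sup>2 / (2 * \<eta>)"
      using mult_right_mono[OF \<eta>(2), of "(s i)\<^sup>2"] \<eta>(1) by (simp add: field_simps)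
    moreover have "2 * s i * (x i \<bullet> (A *v u i)) = 2 * ((s i)\<^sup>2 / (2 * \<eta>))"
      using step_length[OF False] \<eta>(1) by (simp add: power2_eq_square field_simps)
    moreover have "x i \<bullet> (A *v x i) + 2 * s i * (x i \<bullet> (A *v u i)) - (hi - lo) * (s i)\<^sup>2
        \<le> ?y i \<bullet> (A *v ?y i)"
      unfolding geodesic_point_def using s_nonneg[of i] tangent[OF False]
      by (intro form_along_geodesic_ge)
        (auto simp: orthonormal_inner[OF x_orthonormal] orthonormal_inner[OF u_orthonormal])
    ultimately show ?thesis by linarith
  qed (simp add: geodesic_point_def)
  then have "(\<Sum>i\<in>UNIV. x i \<bullet> (A *v x i) + (s i)\<^sup>2 / (2 * \<eta>)) \<le> (\<Sum>i\<in>UNIV. ?y i \<bullet> (A *v ?y i))"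
    by (intro sum_mono)
  then show ?thesis by (simp add: gap_def sum.distrib sum_divide_distrib)
qed

text \<open>
  The overlap with the optimal subspace grows along the negative gradient at a relative rate that is
  exactly the optimality gap. The component of \<open>A x\<^sub>i\<close> in the span of \<open>x\<close> contributes only its
  coefficient at \<open>x\<^sub>i\<close>, since the other coefficients produce repeated columns; what remains is the sum
  of the eigenvalues minus the trace of \<open>X\<^sup>T A X\<close>.
\<close>

lemma sum_det_direction:
  "(\<Sum>i\<in>UNIV. det (gram v (x(i := s i *\<^sub>R u i)))) = 2 * \<eta> * gap x * det (gram v x)"
proof -
  have "det (gram v (x(i := s i *\<^sub>R u i))) =
     2 * \<eta> * (det (gram v (x(i := A *v x i))) - (x i \<bullet> (A *v x i)) * det (gram v x))" for i
    unfolding direction linear_scale[OF linear_det_gram_fun_upd] linear_diff[OF linear_det_gram_fun_upd]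
      det_gram_fun_upd_sum by simp
  then have "(\<Sum>i\<in>UNIV. det (gram v (x(i := s i *\<^sub>R u i)))) =
     2 * \<eta> * (\<Sum>i\<in>UNIV. det (gram v (x(i := A *v x i))) - (x i \<bullet> (A *v x i)) * det (gram v x))"
    by (simp only: sum_distrib_left)
  also have "\<dots> = 2 * \<eta> * gap x * det (gram v x)"
    unfolding sum_subtractf sum_distrib_right[symmetric] sum_det_gram_fun_upd_eigen[OF sym eig] gap_def
    by (simp add: algebra_simps)
  finally show ?thesis .
qed

text \<open>
  This replaces the comparison of geodesic triangles in a nonnegatively curved space: it shows how
  far one step moves towards the span of \<open>v\<close>, measured by the overlap determinant instead of by the
  distance.
\<close>

theorem overlap_step:
  "(1 + 2 * \<eta> * gap x) * \<bar>det (gram v x)\<bar> - (\<Sum>i\<in>UNIV. (s i)\<^sup>2) \<le> \<bar>det (gram v (geodesic_point x u s))\<bar>"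
proof -
  let ?R = "plucker (geodesic_point x u s) - plucker x - (\<Sum>i\<in>UNIV. plucker (x(i := s i *\<^sub>R u i)))"
  have "\<bar>plucker v \<bullet> ?R\<bar> \<le> norm (plucker v) * norm ?R" by (rule Cauchy_Schwarz_ineq2)
  also have "\<dots> \<le> (\<Sum>i\<in>UNIV. (s i)\<^sup>2)"
    using plucker_geodesic_remainder[OF x_orthonormal u_orthonormal tangent s_nonneg step_length_le_1]
    by (simp add: norm_plucker_orthonormal[OF v])
  finally have "\<bar>plucker v \<bullet> ?R\<bar> \<le> (\<Sum>i\<in>UNIV. (s i)\<^sup>2)" .
  moreover have "plucker v \<bullet> ?R = det (gram v (geodesic_point x u s)) - (1 + 2 * \<eta> * gap x) * det (gram v x)"
    by (simp add: inner_diff_right inner_sum_right inner_plucker sum_det_direction algebra_simps)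
  moreover have "\<bar>(1 + 2 * \<eta> * gap x) * det (gram v x)\<bar> = (1 + 2 * \<eta> * gap x) * \<bar>det (gram v x)\<bar>"
    using gap_bounds(1)[OF x_orthonormal] \<eta>(1) by (simp add: abs_mult)
  ultimately show ?thesis by linarith
qed

end

text \<open>
  The squared gradient is controlled by the gap: taking the same direction with the largest step size
  \<open>1 / (2 (hi - lo))\<close> decreases the gap by a fixed multiple of the squared gradient, and the gap stays
  nonnegative. If \<open>hi = lo\<close> the gap is zero and the given step itself shows that the gradient
  vanishes.
\<close>

lemma direction_le_gap:
  assumes dir: "descent_direction A \<eta> x u s" and \<eta>: "0 < \<eta>" "2 * \<eta> * (hi - lo) \<le> 1"
  shows "(\<Sum>i\<in>UNIV. (s i)\<^sup>2) \<le> 4 * (hi - lo) * \<eta>\<^sup>2 * gap x"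
proof -
  define q where "q = (\<Sum>i\<in>UNIV. (s i)\<^sup>2)"
  have x: "orthonormal x" and u: "orthonormal u" using dir by (auto simp: descent_direction_def)
  show ?thesis
  proof (cases "hi = lo")
    case True
    have "0 \<le> gap (geodesic_point x u s)"
      by (intro gap_bounds(1) orthonormal_geodesic_point(1)[OF x u tangent[OF dir \<eta>]])
    also have "\<dots> \<le> gap x - q / (2 * \<eta>)" unfolding q_def by (rule gap_descent[OF dir \<eta>])
    finally have "q / (2 * \<eta>) \<le> 0" using gap_bounds(2)[OF x] by (simp add: True)
    then show ?thesis using \<eta>(1) by (simp add: True q_def divide_le_0_iff)
  next
    case False
    define d where "d = hi - lo"
    have d: "0 < d" using False lo_le_hi by (simp add: d_def)
    \<comment> \<open>Largest admissible step size; the direction is rescaled accordingly.\<close>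
    define \<eta>' where "\<eta>' = 1 / (2 * d)"
    define s' where "s' = (\<lambda>i. (\<eta>' / \<eta>) * s i)"
    have \<eta>': "0 < \<eta>'" "2 * \<eta>' * (hi - lo) \<le> 1" using d by (simp_all add: \<eta>'_def d_def)
    have dir': "descent_direction A \<eta>' x u s'"
    proof -
      have "s' i *\<^sub>R u i = (2 * \<eta>') *\<^sub>R (A *v x i - (\<Sum>j\<in>UNIV. (x j \<bullet> (A *v x i)) *\<^sub>R x j))" for i
      proof -
        have "s' i *\<^sub>R u i = (\<eta>' / \<eta>) *\<^sub>R (s i *\<^sub>R u i)" by (simp add: s'_def)
        then show ?thesis unfolding direction[OF dir \<eta>] using \<eta>(1) by simp
      qed
      moreover have "0 \<le> s' i" for i using s_nonneg[OF dir \<eta>, of i] \<eta> \<eta>' by (simp add: s'_def)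
      ultimately show ?thesis using x u by (simp add: descent_direction_def)
    qed
    have "0 \<le> gap (geodesic_point x u s')"
      by (intro gap_bounds(1) orthonormal_geodesic_point(1)[OF x u tangent[OF dir' \<eta>']])
    also have "\<dots> \<le> gap x - (\<Sum>i\<in>UNIV. (s' i)\<^sup>2) / (2 * \<eta>')" by (rule gap_descent[OF dir' \<eta>'])
    also have "(\<Sum>i\<in>UNIV. (s' i)\<^sup>2) = (\<eta>' / \<eta>)\<^sup>2 * q"
      by (simp add: s'_def q_def power_mult_distrib power_divide sum_distrib_left)
    also have "(\<eta>' / \<eta>)\<^sup>2 * q / (2 * \<eta>') = q / (4 * d * \<eta>\<^sup>2)"
      using d \<eta>(1) by (simp add: \<eta>'_def power2_eq_square field_simps)
    finally have "q / (4 * d * \<eta>\<^sup>2) \<le> gap x" by simp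
    then show ?thesis using d \<eta>(1) by (simp add: q_def d_def pos_divide_le_eq mult_ac)
  qed
qed

end

section \<open>Leading eigenspaces and the characteristic polynomial\<close>

lemma order_prod_linear_factors:
  fixes f :: "'i \<Rightarrow> real"
  assumes "finite S"
  shows "order a (\<Prod>i\<in>S. [:- f i, 1:]) = card {i\<in>S. f i = a}"
  using assms
proof (induction rule: finite_induct)
  case (insert i S)
  have "(\<Prod>j\<in>S. [:- f j, 1:]) \<noteq> 0" using insert.hyps(1) by simp
  then have "order a (\<Prod>j\<in>insert i S. [:- f j, 1:]) = order a [:- f i, 1:] + card {j\<in>S. f j = a}"
    using insert by (simp add: order_mult del: mult_pCons_left)
  also have "order a [:- f i, 1:] = (if f i = a then 1 else 0)"
    using order_power_n_n[of a 1] by (auto simp: order_0I)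
  also have "{j\<in>insert i S. f j = a} = (if f i = a then insert i {j\<in>S. f j = a} else {j\<in>S. f j = a})"
    by auto
  then have "(if f i = a then 1 else 0) + card {j\<in>S. f j = a} = card {j\<in>insert i S. f j = a}"
    using insert.hyps by simp
  finally show ?case .
qed simp

text \<open>
  A product of monic linear factors determines the multiplicity of each root.
\<close>

lemma card_roots_eq:
  fixes f :: "'i \<Rightarrow> real" and g :: "'j \<Rightarrow> real"
  assumes "finite S" "finite T" and eq: "\<And>x. (\<Prod>i\<in>S. x - f i) = (\<Prod>j\<in>T. x - g j)"
  shows "card {i\<in>S. f i = a} = card {j\<in>T. g j = a}"
proof -
  have "poly (\<Prod>i\<in>S. [:- f i, 1:]) = poly (\<Prod>j\<in>T. [:- g j, 1:])"
    using eq by (simp add: fun_eq_iff poly_prod)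
  then have "(\<Prod>i\<in>S. [:- f i, 1:]) = (\<Prod>j\<in>T. [:- g j, 1:])"
    by (simp only: poly_eq_poly_eq_iff)
  then show ?thesis using assms(1,2) by (metis order_prod_linear_factors)
qed

lemma orthonormal_basis_expansion:
  fixes w :: "'n \<Rightarrow> real^'n"
  assumes w: "orthonormal w"
  shows "z = (\<Sum>j\<in>UNIV. (w j \<bullet> z) *\<^sub>R w j)"
proof -
  define W :: "real^'n^'n" where "W = (\<chi> i j. w j $ i)"
  have col: "column j W = w j" for j by (simp add: W_def)
  have "transpose W ** W = mat 1" using w by (simp add: orthonormal_columns_iff col)
  then have "W ** transpose W = mat 1" by (rule matrix_left_right_inverse[THEN iffD1])
  then have "z = W *v (transpose W *v z)"
    by (metis matrix_vector_mul_assoc matrix_vector_mul_lid)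
  also have "\<dots> = (\<Sum>j\<in>UNIV. ((transpose W *v z) $ j) *\<^sub>R w j)"
    by (simp only: matrix_mult_sum col scalar_mult_eq_scaleR)
  also have "\<dots> = (\<Sum>j\<in>UNIV. (w j \<bullet> z) *\<^sub>R w j)"
    by (simp add: vector_matrix_mult_def W_def inner_vec_def mult.commute)
  finally show ?thesis .
qed

lemma det_diag: "det (diag s) = (\<Prod>i\<in>UNIV. s $ i)"
  by (simp add: det_diagonal diag_def)

lemma char_poly_eigenbasis:
  fixes A :: "real^'n^'n" and w :: "'n \<Rightarrow> real^'n"
  assumes w: "orthonormal w" and eig: "\<And>i. A *v w i = d i *\<^sub>R w i"
  shows "det (mat x - A) = (\<Prod>i\<in>UNIV. x - d i)"
proof -
  define W :: "real^'n^'n" where "W = (\<chi> i j. w j $ i)"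
  have col: "column j W = w j" for j by (simp add: W_def)
  have "transpose W ** W = mat 1" using w by (simp add: orthonormal_columns_iff col)
  then have "det W * det W = 1" by (metis det_I det_mul det_transpose)
  then have W: "det W \<noteq> 0" by auto
  have "column j ((mat x - A) ** W) = column j (W ** diag (\<chi> i. x - d i))" for j
  proof -
    have "mat x *v w j = x *\<^sub>R w j"
      by (simp add: vec_eq_iff matrix_vector_mult_def mat_def if_distrib[of "\<lambda>c. c * _"] cong: if_cong)
    then have "column j ((mat x - A) ** W) = (x - d j) *\<^sub>R w j"
      by (simp add: column_mult col matrix_vector_mult_diff_rdistrib eig scaleR_diff_left)
    moreover have "column j (W ** diag (\<chi> i. x - d i)) = (x - d j) *\<^sub>R w j"
      by (simp add: column_mult_diag col)
    ultimately show ?thesis by simp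
  qed
  then have "(mat x - A) ** W = W ** diag (\<chi> i. x - d i)" by (simp add: vec_eq_iff column_def)
  then have "det (mat x - A) * det W = det W * (\<Prod>i\<in>UNIV. x - d i)"
    by (metis (no_types, lifting) det_diag det_mul prod.cong vec_lambda_beta)
  then show ?thesis using W by simp
qed

text \<open>
  The given leading eigenvectors are completed to an eigenbasis \<open>w\<close> of the whole space. Comparing
  characteristic polynomials, every value occurs among the eigenvalues \<open>d\<close> of \<open>w\<close> as often as among
  \<open>lam\<close>. An added basis vector cannot have an eigenvalue above \<open>lam k\<close>: all occurrences of such a value
  among \<open>lam\<close> have an index at most \<open>k\<close> and are used up by the given eigenvectors. The vectors are
  finally indexed by the column type of the representatives.
\<close>

theorem leading_frame_exists:
  fixes A :: "real^'n^'n"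
  assumes k: "CARD('k::finite) \<le> CARD('n)" and sym: "transpose A = A"
    and ev: "eigenvalues_desc A lam" and lead: "leading_eigenspace A lam CARD('k) S"
  shows "\<exists>(v :: 'k \<Rightarrow> real^'n) \<mu>. leading_frame A (lam CARD('n)) (lam 1) v \<mu> (lam CARD('k)) \<and>
      span (range v) = S \<and> (\<Sum>l\<in>UNIV. \<mu> l) = (\<Sum>i=1..CARD('k). lam i)"
proof -
  define n k where "n = CARD('n)" and "k = CARD('k)"
  have kn: "k \<le> n" and k0: "0 < k" using k by (auto simp: n_def k_def)
  have anti: "lam j \<le> lam i" if "1 \<le> i" "i \<le> j" "j \<le> n" for i j
    using ev that by (auto simp: eigenvalues_desc_def n_def monotone_on_def)
  obtain v0 where v0: "\<And>i j. i \<in> {1..k} \<Longrightarrow> j \<in> {1..k} \<Longrightarrow> v0 i \<bullet> v0 j = (if i = j then 1 else 0)"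
    and Av0: "\<And>i. i \<in> {1..k} \<Longrightarrow> A *v v0 i = lam i *\<^sub>R v0 i" and S: "S = span (v0 ` {1..k})"
    using lead unfolding leading_eigenspace_def k_def by blast
  obtain h :: "nat \<Rightarrow> 'n" where h: "bij_betw h {1..n} UNIV"
    using ex_bij_betw_nat_finite_1[of "UNIV :: 'n set"] by (auto simp: n_def)
  define g where "g = inv_into {1..n} h"
  have gh: "g (h i) = i" if "i \<in> {1..n}" for i
    using h that by (simp add: g_def bij_betw_inv_into_left)
  define I where "I = h ` {1..k}"
  have gI: "g j \<in> {1..k}" "h (g j) = j" if "j \<in> I" for j
    using that gh kn by (auto simp: I_def)
  have "orthonormal_on I (v0 \<circ> g)"
    unfolding orthonormal_on_def
  proof (intro ballI)
    fix i j assume ij: "i \<in> I" "j \<in> I"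
    then have "g i = g j \<longleftrightarrow> i = j" using gI(2) by metis
    then show "(v0 \<circ> g) i \<bullet> (v0 \<circ> g) j = (if i = j then 1 else 0)"
      using v0[OF gI(1)[OF ij(1)] gI(1)[OF ij(2)]] by simp
  qed
  moreover have "\<forall>i\<in>I. \<exists>d. A *v (v0 \<circ> g) i = d *\<^sub>R (v0 \<circ> g) i"
    using Av0 gI(1) by auto
  ultimately obtain w d where wI: "\<forall>i\<in>I. w i = (v0 \<circ> g) i" and w: "orthonormal w"
    and Aw: "\<And>i. A *v w i = d i *\<^sub>R w i"
    using symmetric_eigenbasis_extend[OF sym, of I "v0 \<circ> g"] by auto
  \<comment> \<open>The eigenvalue obtained from the extension is the prescribed one because \<open>v0 i\<close> is nonzero.\<close>
  have dh: "d (h i) = lam i" if i: "i \<in> {1..k}" for i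
  proof -
    have "h i \<in> I" using i by (simp add: I_def)
    then have "w (h i) = v0 i" using wI gh[of i] i kn by simp
    then have "d (h i) *\<^sub>R v0 i = lam i *\<^sub>R v0 i" using Aw[of "h i"] Av0[OF i] by metis
    moreover have "v0 i \<noteq> 0" using v0[OF i i] by auto
    ultimately show ?thesis by (simp only: scaleR_cancel_right) simp
  qed
  have mult: "card {j. d j = a} = card {i\<in>{1..n}. lam i = a}" for a
  proof -
    have "card {j\<in>UNIV. d j = a} = card {i\<in>{1..n}. lam i = a}"
    proof (rule card_roots_eq)
      fix x
      show "(\<Prod>j\<in>UNIV. x - d j) = (\<Prod>i\<in>{1..n}. x - lam i)"
        using char_poly_eigenbasis[OF w Aw, of x] ev by (simp add: eigenvalues_desc_def n_def)
    qed auto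
    then show ?thesis by simp
  qed
  have d_lam: "\<exists>i\<in>{1..n}. d j = lam i" for j
  proof -
    \<comment> \<open>Every eigenvalue of the basis occurs at least once among the roots.\<close>
    have "card {j'. d j' = d j} \<noteq> 0" by auto
    then have "{i\<in>{1..n}. lam i = d j} \<noteq> {}" unfolding mult by (metis card.empty)
    then obtain i where "i \<in> {1..n}" "lam i = d j" by blast
    then show ?thesis by (intro bexI[of _ i]) simp_all
  qed
  have d_ge: "lam n \<le> d j" and d_le: "d j \<le> lam 1" for j
    using d_lam[of j] anti by auto
  have d_compl: "d j \<le> lam k" if j: "j \<notin> I" for j
  proof (rule ccontr)
    assume "\<not> d j \<le> lam k"
    then have lt: "lam k < d j" by simp
    let ?L = "{i\<in>{1..n}. lam i = d j}"
    have L: "?L \<subseteq> {1..k}"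
    proof
      fix i assume i: "i \<in> ?L"
      then have "\<not> k \<le> i" using anti[of k i] k0 lt by auto
      then show "i \<in> {1..k}" using i by auto
    qed
    have inj: "inj_on h ?L" by (rule inj_on_subset[OF bij_betw_imp_inj_on[OF h]]) auto
    have "j \<notin> h ` ?L" using j L by (auto simp: I_def)
    then have "card (insert j (h ` ?L)) = Suc (card ?L)" 
      using card_image[OF inj] by simp
    moreover have "insert j (h ` ?L) \<subseteq> {j'. d j' = d j}"
    proof
      fix j' assume "j' \<in> insert j (h ` ?L)"
      then consider "j' = j" | i where "j' = h i" "i \<in> ?L" by auto
      then show "j' \<in> {j'. d j' = d j}"
      proof cases
        case 2
        then have "i \<in> {1..k}" using L by auto
        then show ?thesis using dh 2 by simp
      qed simp
    qed
    then have "card (insert j (h ` ?L)) \<le> card {j'. d j' = d j}" by (intro card_mono) auto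
    ultimately show False using mult[of "d j"] by simp
  qed
  have zz: "z \<bullet> z = (\<Sum>j\<in>UNIV. (w j \<bullet> z)\<^sup>2)" for z
  proof -
    have "z \<bullet> z = z \<bullet> (\<Sum>j\<in>UNIV. (w j \<bullet> z) *\<^sub>R w j)"
      using orthonormal_basis_expansion[OF w, of z] by simp
    then show ?thesis by (simp add: inner_sum_right power2_eq_square inner_commute[of z "w _"])
  qed
  have zAz: "z \<bullet> (A *v z) = (\<Sum>j\<in>UNIV. d j * (w j \<bullet> z)\<^sup>2)" for z
  proof -
    have "A *v z = A *v (\<Sum>j\<in>UNIV. (w j \<bullet> z) *\<^sub>R w j)"
      using orthonormal_basis_expansion[OF w, of z] by simp
    also have "\<dots> = (\<Sum>j\<in>UNIV. ((w j \<bullet> z) * d j) *\<^sub>R w j)"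
      by (simp add: linear_sum[OF matrix_vector_mul_linear] matrix_vector_mult_scaleR Aw)
    finally show ?thesis
      by (simp add: inner_sum_right power2_eq_square inner_commute[of z "w _"] mult_ac)
  qed
  obtain e :: "nat \<Rightarrow> 'k" where e: "bij_betw e {1..k} UNIV"
    using ex_bij_betw_nat_finite_1[of "UNIV :: 'k set"] by (auto simp: k_def)
  define f where "f = inv_into {1..k} e"
  have f: "bij_betw f UNIV {1..k}" using e by (simp add: f_def bij_betw_inv_into)
  have fk: "f l \<in> {1..k}" for l using f by (auto simp: bij_betw_def)
  have f_eq: "f l = f m \<longleftrightarrow> l = m" for l m using f by (auto simp: bij_betw_def inj_on_def)
  define v where "v = v0 \<circ> f"
  define \<mu> where "\<mu> = lam \<circ> f"
  have "leading_frame A (lam n) (lam 1) v \<mu> (lam k)"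
  proof
    fix z
    show "lam n * (z \<bullet> z) \<le> z \<bullet> (A *v z)" "z \<bullet> (A *v z) \<le> lam 1 * (z \<bullet> z)"
      unfolding zz zAz sum_distrib_left by (intro sum_mono mult_right_mono d_ge d_le; simp)+
    assume z: "\<And>l. v l \<bullet> z = 0"
    have "w j \<bullet> z = 0" if j: "j \<in> I" for j
    proof -
      obtain l where "f l = g j" using gI(1)[OF j] f by (metis bij_betw_imp_surj_on imageE)
      then show ?thesis using z[of l] wI j by (simp add: v_def)
    qed
    then have "d j * (w j \<bullet> z)\<^sup>2 \<le> lam k * (w j \<bullet> z)\<^sup>2" for j
      using d_compl[of j] by (cases "j \<in> I") (auto intro: mult_right_mono)
    then show "z \<bullet> (A *v z) \<le> lam k * (z \<bullet> z)"
      unfolding zz zAz sum_distrib_left by (intro sum_mono)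
  next
    show "orthonormal v" using v0 fk f_eq by (simp add: orthonormal_on_def v_def)
    show "A *v v l = \<mu> l *\<^sub>R v l" for l using Av0 fk by (simp add: v_def \<mu>_def)
    show "lam k \<le> \<mu> l" for l using anti[of "f l" k] fk[of l] kn by (simp add: \<mu>_def)
    show "\<mu> l \<le> lam 1" for l using anti[of 1 "f l"] fk[of l] kn by (simp add: \<mu>_def)
  qed (fact sym)
  moreover have "range v = v0 ` {1..k}"
    using f by (metis bij_betw_imp_surj_on image_comp v_def)
  moreover have "(\<Sum>l\<in>UNIV. \<mu> l) = (\<Sum>i=1..k. lam i)"
    using sum.reindex_bij_betw[OF f, of lam] by (simp add: \<mu>_def)
  ultimately show ?thesis unfolding S n_def k_def by (intro exI[of _ v] exI[of _ \<mu>]) simp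
qed

section \<open>Principal angles and the exponential map\<close>

lemma column_mult_in_span: "column j (X ** Y) \<in> span (columns (X :: real^'k^'n))"
  by (simp add: column_mult matrix_vector_mult_in_columnspace)

lemma columns_eq_range: "columns X = range (\<lambda>j. column j X)"
  by (auto simp: columns_def)

lemma representative_orthonormal:
  fixes X :: "real^'k^'n"
  shows "represents X S \<Longrightarrow> orthonormal (\<lambda>i. column i X)"
  by (simp add: represents_def orthonormal_columns_iff)

lemma orthonormal_columns_mult:
  fixes X :: "real^'k^'n" and W :: "real^'k^'k"
  assumes "transpose X ** X = mat 1" "transpose W ** W = mat 1"
  shows "transpose (X ** W) ** (X ** W) = mat 1"
proof -
  have "transpose (X ** W) ** (X ** W) = transpose W ** (transpose X ** X) ** W"
    by (simp only: matrix_transpose_mul matrix_mul_assoc)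
  then show ?thesis using assms by simp
qed

text \<open>
  Bases of principal vectors: multiplying both representatives by the singular vectors of \<open>V\<^sup>T X\<close>
  diagonalises the matrix of inner products.
\<close>

theorem principal_frames:
  fixes X V :: "real^'k^'n"
  assumes X: "transpose X ** X = mat 1" and V: "transpose V ** V = mat 1"
  defines "\<sigma> \<equiv> singular_values (transpose V ** X)"
  shows "\<exists>(x :: 'k \<Rightarrow> real^'n) (v :: 'k \<Rightarrow> real^'n). orthonormal x \<and> orthonormal v \<and>
      (\<forall>i. x i \<in> span (columns X)) \<and> (\<forall>i. v i \<in> span (columns V)) \<and>
      (\<forall>i j. v i \<bullet> x j = (if i = j then \<sigma> $ i else 0)) \<and> (\<forall>i. 0 \<le> \<sigma> $ i)"
proof -
  have "\<exists>U W. compact_svd (transpose V ** X) U \<sigma> W"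
    unfolding \<sigma>_def singular_values_def
    by (rule someI_ex) (use compact_svd_exists[of "transpose V ** X"] in blast)
  then obtain U W where svd: "compact_svd (transpose V ** X) U \<sigma> W" by blast
  then have U: "transpose U ** U = mat 1" and W: "transpose W ** W = mat 1"
    and \<sigma>: "\<And>i. 0 \<le> \<sigma> $ i" and eq: "transpose V ** X = U ** diag \<sigma> ** transpose W"
    by (auto simp: compact_svd_def)
  have "transpose (V ** U) ** (X ** W) = transpose U ** (transpose V ** X) ** W"
    by (simp only: matrix_transpose_mul matrix_mul_assoc)
  also have "\<dots> = (transpose U ** U) ** diag \<sigma> ** (transpose W ** W)"
    unfolding eq by (simp only: matrix_mul_assoc)
  finally have "transpose (V ** U) ** (X ** W) = diag \<sigma>" by (simp add: U W)
  then have "column i (V ** U) \<bullet> column j (X ** W) = diag \<sigma> $ i $ j" for i j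
    by (simp add: transpose_mult_eq_inner_columns vec_eq_iff)
  then have "column i (V ** U) \<bullet> column j (X ** W) = (if i = j then \<sigma> $ i else 0)" for i j
    by (simp add: diag_def)
  then show ?thesis
    using orthonormal_columns_mult[OF X W] orthonormal_columns_mult[OF V U] \<sigma>
    by (intro exI[of _ "\<lambda>j. column j (X ** W)"] exI[of _ "\<lambda>j. column j (V ** U)"])
      (simp add: column_mult_in_span orthonormal_columns_iff)
qed

lemma gr_dist_nonneg: "0 \<le> gr_dist X V"
  by (simp add: gr_dist_def sum_nonneg)

text \<open>
  In bases of principal vectors the overlap determinant is the product of the cosines of the principal
  angles, and the mass of one subspace outside the other is the sum of the squared sines.
\<close>

lemma overlap_and_dist:
  fixes X V :: "real^'k^'n" and v :: "'k \<Rightarrow> real^'n"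
  assumes X: "represents X S" and V: "represents V T" and v: "orthonormal v" "span (range v) = T"
  shows "gr_dist X V \<le> pi / 2 \<Longrightarrow> cos (gr_dist X V) \<le> \<bar>det (gram v (\<lambda>i. column i X))\<bar>"
    and "CARD('k) - (\<Sum>i\<in>UNIV. \<Sum>l\<in>UNIV. (v l \<bullet> column i X)\<^sup>2) \<le> (gr_dist X V)\<^sup>2"
proof -
  define \<sigma> where "\<sigma> = singular_values (transpose V ** X)"
  define \<theta> where "\<theta> i = arccos (\<sigma> $ i)" for i
  define c where "c = (\<lambda>i. column i X)"
  have c: "orthonormal c" unfolding c_def by (rule representative_orthonormal[OF X])
  have XV: "transpose X ** X = mat 1" "transpose V ** V = mat 1" "span (columns X) = S" "span (columns V) = T"
    using X V by (auto simp: represents_def)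
  obtain x w :: "'k \<Rightarrow> real^'n" where x: "orthonormal x" and w: "orthonormal w"
    and xs: "\<And>i. x i \<in> span (range c)" and ws: "\<And>i. w i \<in> span (range v)"
    and wx: "\<And>i j. w i \<bullet> x j = (if i = j then \<sigma> $ i else 0)" and \<sigma>0: "\<And>i. 0 \<le> \<sigma> $ i"
    using principal_frames[OF XV(1,2)] unfolding XV(3,4) v(2) \<sigma>_def[symmetric]
    by (auto simp: XV(3)[symmetric] columns_eq_range c_def)
  have \<sigma>1: "\<sigma> $ i \<le> 1" for i
    using Cauchy_Schwarz_ineq2[of "w i" "x i"] \<sigma>0[of i]
    by (simp add: wx norm_eq_sqrt_inner orthonormal_inner[OF x] orthonormal_inner[OF w])
  have cos_\<theta>: "cos (\<theta> i) = \<sigma> $ i" and \<theta>0: "0 \<le> \<theta> i" for i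
    using \<sigma>0[of i] \<sigma>1[of i] by (auto simp: \<theta>_def intro!: cos_arccos arccos_lbound)
  have dist: "gr_dist X V = sqrt (\<Sum>i\<in>UNIV. (\<theta> i)\<^sup>2)"
    by (simp add: gr_dist_def principal_angles_def \<theta>_def \<sigma>_def)
  have dist2: "(gr_dist X V)\<^sup>2 = (\<Sum>i\<in>UNIV. (\<theta> i)\<^sup>2)"
    by (simp add: dist sum_nonneg)
  show "cos (gr_dist X V) \<le> \<bar>det (gram v (\<lambda>i. column i X))\<bar>" if "gr_dist X V \<le> pi / 2"
  proof -
    have "(\<Sum>i\<in>UNIV. (\<theta> i)\<^sup>2) \<le> (pi / 2)\<^sup>2"
      using power_mono[OF that gr_dist_nonneg, of 2] by (simp add: dist2)
    then have "cos (gr_dist X V) \<le> (\<Prod>i\<in>UNIV. cos (\<theta> i))"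
      unfolding dist by (intro cos_sqrt_sum_le_prod_cos) (auto simp: \<theta>0)
    also have "\<dots> = det (gram w x)" by (simp add: det_diagonal wx cos_\<theta>)
    also have "\<dots> \<le> \<bar>det (gram w x)\<bar>" by simp
    also have "\<dots> = \<bar>det (gram w c)\<bar>" by (rule abs_det_gram_change_of_frame[OF c x xs])
    also have "\<dots> = \<bar>det (gram v c)\<bar>"
      using abs_det_gram_change_of_frame[OF v(1) w ws, of c] by (simp add: det_gram_commute[of c])
    finally show ?thesis by (simp add: c_def)
  qed
  have bil: "bilinear (\<lambda>a b. (a \<bullet> z) * (b \<bullet> z))" for z :: "real^'n"
    by (auto simp: bilinear_def inner_add_left algebra_simps intro!: linearI)
  have bil2: "bilinear (\<lambda>a b. \<Sum>l\<in>UNIV. (v l \<bullet> a) * (v l \<bullet> b))"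
    by (auto simp: bilinear_def inner_add_right algebra_simps sum.distrib sum_distrib_left intro!: linearI)
  have frame: "(\<Sum>l\<in>UNIV. (v l \<bullet> z)\<^sup>2) = (\<Sum>l\<in>UNIV. (w l \<bullet> z)\<^sup>2)" for z
    using sum_bilinear_change_of_frame[OF v(1) w ws bil[of z]] by (simp add: power2_eq_square)
  have "(\<Sum>i\<in>UNIV. \<Sum>l\<in>UNIV. (v l \<bullet> column i X)\<^sup>2) = (\<Sum>i\<in>UNIV. \<Sum>l\<in>UNIV. (v l \<bullet> x i)\<^sup>2)"
    using sum_bilinear_change_of_frame[OF c x xs bil2] by (simp add: power2_eq_square c_def)
  also have "\<dots> = (\<Sum>i\<in>UNIV. (\<sigma> $ i)\<^sup>2)"
  proof (rule sum.cong[OF refl])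
    fix i
    have "(\<Sum>l\<in>UNIV. (w l \<bullet> x i)\<^sup>2) = (\<Sum>l\<in>UNIV. if l = i then (\<sigma> $ i)\<^sup>2 else 0)"
      by (intro sum.cong refl) (simp add: wx)
    then show "(\<Sum>l\<in>UNIV. (v l \<bullet> x i)\<^sup>2) = (\<sigma> $ i)\<^sup>2" by (simp add: frame)
  qed
  finally have "CARD('k) - (\<Sum>i\<in>UNIV. \<Sum>l\<in>UNIV. (v l \<bullet> column i X)\<^sup>2) = (\<Sum>i\<in>UNIV. 1 - (\<sigma> $ i)\<^sup>2)"
    by (simp add: sum_subtractf)
  also have "\<dots> \<le> (\<Sum>i\<in>UNIV. (\<theta> i)\<^sup>2)"
  proof (rule sum_mono)
    fix i
    have "\<bar>sin (\<theta> i)\<bar> \<le> \<bar>\<theta> i\<bar>" by (rule abs_sin_x_le_abs_x)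
    then have "(sin (\<theta> i))\<^sup>2 \<le> (\<theta> i)\<^sup>2" by (simp only: abs_le_square_iff)
    then show "1 - (\<sigma> $ i)\<^sup>2 \<le> (\<theta> i)\<^sup>2" by (simp add: sin_squared_eq cos_\<theta>)
  qed
  finally show "CARD('k) - (\<Sum>i\<in>UNIV. \<Sum>l\<in>UNIV. (v l \<bullet> column i X)\<^sup>2) \<le> (gr_dist X V)\<^sup>2"
    by (simp add: dist2)
qed

text \<open>
  The basis \<open>x\<close> is \<open>X W\<close>, where \<open>W\<close> contains the right singular vectors of the step. Since \<open>X X\<^sup>T\<close> is the
  orthogonal projection on the span for either basis, \<open>x\<close> satisfies the gradient equation again.
\<close>

theorem gr_exp_descent_step:
  fixes A :: "real^'n^'n" and X X' :: "real^'k^'n"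
  assumes k: "CARD('k) \<le> CARD('n)" and X: "represents X S"
    and X': "represents X' (gr_exp X (- \<eta> *\<^sub>R gr_grad A X))"
  shows "\<exists>(x :: 'k \<Rightarrow> real^'n) u s. descent_direction A \<eta> x u s \<and> (\<forall>i. x i \<in> span (range (\<lambda>i. column i X))) \<and>
      (\<forall>i. column i X' \<in> span (range (geodesic_point x u s)))"
proof -
  define G where "G = - \<eta> *\<^sub>R gr_grad A X"
  let ?E = "\<lambda>U s W. X ** W ** diag (\<chi> i. cos (s $ i)) + U ** diag (\<chi> i. sin (s $ i))"
  have "\<exists>U s W. compact_svd G U s W \<and> gr_exp X G = span (columns (?E U s W))"
    unfolding gr_exp_def by (rule someI_ex) (use compact_svd_exists[OF k, of G] in blast)
  then obtain U s W where svd: "compact_svd G U s W" and exp: "gr_exp X G = span (columns (?E U s W))"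
    by blast
  from svd have U: "transpose U ** U = mat 1" and W: "transpose W ** W = mat 1"
    and s: "\<And>i. 0 \<le> s $ i" and G: "G = U ** diag s ** transpose W"
    by (auto simp: compact_svd_def)
  have XX: "transpose X ** X = mat 1" using X by (simp add: represents_def)
  define x where "x = (\<lambda>i. column i (X ** W))"
  define u where "u = (\<lambda>i. column i U)"
  have x: "orthonormal x"
    using orthonormal_columns_mult[OF XX W] by (simp add: x_def orthonormal_columns_iff)
  have u: "orthonormal u" using U by (simp add: u_def orthonormal_columns_iff)
  have proj: "(X ** transpose X) *v z = (\<Sum>j\<in>UNIV. (x j \<bullet> z) *\<^sub>R x j)" for z
  proof -
    have "W ** transpose W = mat 1" using W by (rule matrix_left_right_inverse[THEN iffD1])
    then have "X ** transpose X = X ** (W ** transpose W) ** transpose X" by simp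
    also have "\<dots> = (X ** W) ** transpose (X ** W)"
      by (simp only: matrix_transpose_mul matrix_mul_assoc)
    finally have "(X ** transpose X) *v z = (X ** W) *v (transpose (X ** W) *v z)"
      by (simp only: matrix_vector_mul_assoc)
    also have "\<dots> = (\<Sum>j\<in>UNIV. ((transpose (X ** W) *v z) $ j) *\<^sub>R x j)"
      by (simp only: matrix_mult_sum x_def scalar_mult_eq_scaleR)
    also have "\<dots> = (\<Sum>j\<in>UNIV. (x j \<bullet> z) *\<^sub>R x j)"
      by (simp add: vector_matrix_mult_def x_def column_def inner_vec_def mult.commute)
    finally show ?thesis .
  qed
  have "s $ i *\<^sub>R u i = (2 * \<eta>) *\<^sub>R (A *v x i - (\<Sum>j\<in>UNIV. (x j \<bullet> (A *v x i)) *\<^sub>R x j))" for i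
  proof -
    have "G ** W = U ** diag s ** (transpose W ** W)" unfolding G by (simp only: matrix_mul_assoc)
    then have "column i (G ** W) = s $ i *\<^sub>R u i" by (simp add: W column_mult_diag u_def)
    moreover have "column i (G ** W) = (2 * \<eta>) *\<^sub>R (((mat 1 - X ** transpose X) ** A) *v x i)"
      unfolding G_def gr_grad_def column_mult x_def
      by (simp add: scaleR_matrix_vector_assoc[symmetric] matrix_vector_mul_assoc)
    moreover have "((mat 1 - X ** transpose X) ** A) *v x i = A *v x i - (\<Sum>j\<in>UNIV. (x j \<bullet> (A *v x i)) *\<^sub>R x j)"
      by (simp add: matrix_vector_mul_assoc[symmetric] matrix_vector_mult_diff_rdistrib flip: proj)
    ultimately show ?thesis by metis
  qed
  then have "descent_direction A \<eta> x u (($) s)" using x u s by (simp add: descent_direction_def)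
  moreover have "x i \<in> span (range (\<lambda>i. column i X))" for i
    unfolding x_def columns_eq_range[symmetric] by (rule column_mult_in_span)
  moreover have "column i X' \<in> span (range (geodesic_point x u (($) s)))" for i
  proof -
    have "column j (?E U s W) = geodesic_point x u (($) s) j" for j
    proof -
      have "column j (?E U s W) = column j (X ** W ** diag (\<chi> i. cos (s $ i))) + column j (U ** diag (\<chi> i. sin (s $ i)))"
        by (simp add: column_def vec_eq_iff)
      then show ?thesis by (simp add: column_mult_diag geodesic_point_def x_def u_def)
    qed
    then have "columns (?E U s W) = range (geodesic_point x u (($) s))"
      unfolding columns_eq_range by simp
    moreover have "column i X' \<in> span (columns X')"
      by (intro span_base) (auto simp: columns_def)
    ultimately show ?thesis using X' exp by (simp add: represents_def G_def)
  qed
  ultimately show ?thesis by (intro exI[of _ x] exI[of _ u] exI[of _ "($) s"]) simp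
qed

section \<open>Rate of convergence\<close>

lemma objective_columns:
  fixes A :: "real^'n^'n" and X :: "real^'k^'n"
  shows "objective A X = - (\<Sum>i\<in>UNIV. column i X \<bullet> (A *v column i X))"
proof -
  have "transpose X ** A ** X = transpose X ** (A ** X)" by (simp only: matrix_mul_assoc)
  then show ?thesis
    by (simp add: objective_def trace_def transpose_mult_eq_inner_columns column_mult)
qed

lemma (in leading_frame) gap_change_of_frame:
  assumes "orthonormal x" "orthonormal y" "\<And>i. y i \<in> span (range x)"
  shows "gap y = gap x"
proof -
  have "bilinear (\<lambda>a b. a \<bullet> (A *v b))"
    by (auto simp: bilinear_def inner_add_left inner_add_right matrix_vector_right_distrib
        matrix_vector_mult_scaleR intro!: linearI)
  from sum_bilinear_change_of_frame[OF assms this] show ?thesis by (simp add: gap_def)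
qed

text \<open>
  Here \<open>D\<close> is the optimality gap, \<open>p\<close> the overlap and \<open>q\<close> the squared step length. The bound on \<open>q\<close> and
  \<open>\<eta> \<gamma> \<le> a\<close> keep \<open>p\<close> nondecreasing, hence above \<open>a\<close>. In each step \<open>2 (1 - p)\<close> loses \<open>4 a \<eta> D\<close>, which
  pays for the growth of the weight of \<open>D\<close>, and gains at most \<open>2 q\<close>, which the weighted decrease of \<open>D\<close>
  compensates.
\<close>

lemma lyapunov_decrease:
  fixes D p q :: "nat \<Rightarrow> real" and a \<eta> \<gamma> :: real
  assumes a: "0 \<le> a" "a \<le> p 0" and \<eta>: "0 < \<eta>" "\<eta> * \<gamma> \<le> a"
    and D: "\<And>t. 0 \<le> D t" and q: "\<And>t. 0 \<le> q t"
    and descent: "\<And>t. D (Suc t) \<le> D t - q t / (2 * \<eta>)"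
    and overlap: "\<And>t. (1 + 2 * \<eta> * D t) * p t - q t \<le> p (Suc t)"
    and grad: "\<And>t. q t \<le> 2 * \<gamma> * \<eta>\<^sup>2 * D t"
  shows "a \<le> p t \<and> 4 * \<eta> * (a * real t + 1) * D t + 2 * (1 - p t) \<le> 4 * \<eta> * D 0 + 2 * (1 - p 0)"
proof (induction t)
  case 0
  then show ?case using a by simp
next
  case (Suc t)
  have "\<eta> * D t * a \<le> \<eta> * D t * p t" using Suc \<eta>(1) D[of t] by (intro mult_left_mono) auto
  then have p_step: "p t + 2 * (\<eta> * D t * a) - q t \<le> p (Suc t)"
    using overlap[of t] by (simp add: algebra_simps)
  have "(\<eta> * \<gamma>) * (\<eta> * D t) \<le> a * (\<eta> * D t)"
    using \<eta> D[of t] by (intro mult_right_mono) auto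
  then have "q t \<le> 2 * (\<eta> * D t * a)"
    using grad[of t] by (simp add: power2_eq_square algebra_simps)
  then have "p t \<le> p (Suc t)" using p_step by linarith
  then have a_le: "a \<le> p (Suc t)" using Suc by linarith
  define E where "E t = 4 * \<eta> * (a * real t + 1) * D t" for t
  have "E (Suc t) \<le> 4 * \<eta> * (a * real (Suc t) + 1) * (D t - q t / (2 * \<eta>))"
    unfolding E_def using descent[of t] \<eta>(1) a(1) by (intro mult_left_mono) auto
  also have "\<dots> = E t + 4 * (\<eta> * D t * a) - 2 * q t - 2 * (a * real (Suc t) * q t)"
    using \<eta>(1) by (simp add: E_def field_simps)
  also have "\<dots> \<le> E t + 4 * (\<eta> * D t * a) - 2 * q t" using a(1) q[of t] by simp
  finally have "E (Suc t) \<le> E t + 4 * (\<eta> * D t * a) - 2 * q t" .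
  moreover have "2 * p t + 4 * (\<eta> * D t * a) - 2 * q t \<le> 2 * p (Suc t)"
    using mult_left_mono[OF p_step, of 2] by simp
  ultimately have "E (Suc t) + 2 * (1 - p (Suc t)) \<le> E t + 2 * (1 - p t)" by simp
  then show ?case using Suc a_le unfolding E_def by linarith
qed

theorem theorem14:
  fixes A :: "real^'n^'n"
    and lam :: "nat \<Rightarrow> real"
    and \<V> :: "(real^'n) set" and V :: "real^'k^'n"
    and \<X> :: "nat \<Rightarrow> (real^'n) set" and X :: "nat \<Rightarrow> real^'k^'n"
    and \<eta> \<gamma> fstar :: real
  assumes "1 \<le> CARD('k)" and "CARD('k) \<le> CARD('n) - 1"
    and "pos_semidef A"
    and "eigenvalues_desc A lam"
    and "\<gamma> = 2 * (lam 1 - lam CARD('n))"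
    and "fstar = - (\<Sum>i=1..CARD('k). lam i)"
    and "leading_eigenspace A lam CARD('k) \<V>" and "represents V \<V>"
    and "gr_dist (X 0) V < pi / 2"
    and "0 < \<eta>"
    and "\<gamma> \<noteq> 0 \<longrightarrow> \<eta> \<le> cos (gr_dist (X 0) V) / \<gamma>"
    and "steepest_descent A \<eta> \<X> X"
  shows "(\<forall>t. objective A (X t) - fstar
            \<le> (2 * \<gamma> + 1 / \<eta>) / (4 * (cos (gr_dist (X 0) V) * real t + 1)) * (gr_dist (X 0) V)\<^sup>2)
       \<and> (\<lambda>t. objective A (X t) - fstar) \<in> O(\<lambda>t. 1 / real t)"
proof -
  have kn: "CARD('k) \<le> CARD('n)" using assms(2) by linarith
  have sym: "transpose A = A" using assms(3) by (simp add: pos_semidef_def)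
  define d a where "d = gr_dist (X 0) V" and "a = cos d"
  obtain v :: "'k \<Rightarrow> real^'n" and \<mu> where
    "leading_frame A (lam CARD('n)) (lam 1) v \<mu> (lam CARD('k))"
    and span_v: "span (range v) = \<V>" and sum_\<mu>: "(\<Sum>l\<in>UNIV. \<mu> l) = (\<Sum>i=1..CARD('k). lam i)"
    using leading_frame_exists[OF kn sym assms(4,7)] by blast
  then interpret leading_frame A "lam CARD('n)" "lam 1" v \<mu> "lam CARD('k)" by simp
  define c where "c t = (\<lambda>i. column i (X t))" for t
  define D where "D t = gap (c t)" for t
  define p where "p t = \<bar>det (gram v (c t))\<bar>" for t
  have rep: "represents (X t) (\<X> t)" for t
    using assms(12) by (simp add: steepest_descent_def)
  have c: "orthonormal (c t)" for t
    unfolding c_def by (rule representative_orthonormal[OF rep])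
  have obj: "objective A (X t) - fstar = D t" for t
    by (simp add: D_def gap_def objective_columns c_def assms(6) sum_\<mu>)
  have d: "0 \<le> d" "d < pi / 2" using assms(9) by (simp_all add: d_def gr_dist_nonneg)
  have a: "0 < a" "a \<le> 1" using d by (auto simp: a_def intro!: cos_gt_zero_pi)
  have \<gamma>: "0 \<le> \<gamma>" using lo_le_hi assms(5) by simp
  \<comment> \<open>For \<open>\<gamma> = 0\<close> the step size is unconstrained, and the product is zero.\<close>
  have \<eta>\<gamma>: "\<eta> * \<gamma> \<le> a"
    using assms(11) \<gamma> a by (cases "\<gamma> = 0") (auto simp: d_def a_def pos_le_divide_eq)
  then have \<eta>: "2 * \<eta> * (lam 1 - lam CARD('n)) \<le> 1" using a(2) assms(5) by (simp add: algebra_simps)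
  have D0: "0 \<le> D t" for t unfolding D_def by (rule gap_bounds(1)[OF c])
  have p0: "a \<le> p 0"
    unfolding a_def p_def d_def c_def
    by (rule overlap_and_dist(1)[OF rep assms(8) v span_v]) (use assms(9) in simp)
  have D_init: "2 * D 0 \<le> \<gamma> * d\<^sup>2"
  proof -
    have "D 0 \<le> (lam 1 - lam CARD('n)) * (CARD('k) - (\<Sum>i\<in>UNIV. \<Sum>l\<in>UNIV. (v l \<bullet> column i (X 0))\<^sup>2))"
      using gap_bounds(2)[OF c[of 0]] by (simp add: D_def c_def)
    also have "\<dots> \<le> (lam 1 - lam CARD('n)) * d\<^sup>2"
      unfolding d_def using lo_le_hi
      by (intro mult_left_mono overlap_and_dist(2)[OF rep assms(8) v span_v]) simp
    finally have "2 * D 0 \<le> 2 * ((lam 1 - lam CARD('n)) * d\<^sup>2)" by linarith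
    then show ?thesis by (simp only: assms(5) mult.assoc)
  qed
  have "\<exists>q\<ge>0. D (Suc t) \<le> D t - q / (2 * \<eta>) \<and> (1 + 2 * \<eta> * D t) * p t - q \<le> p (Suc t) \<and>
      q \<le> 2 * \<gamma> * \<eta>\<^sup>2 * D t" for t
  proof -
    have "represents (X (Suc t)) (gr_exp (X t) (- \<eta> *\<^sub>R gr_grad A (X t)))"
      using assms(12) by (metis steepest_descent_def)
    from gr_exp_descent_step[OF kn rep this] obtain x u :: "'k \<Rightarrow> real^'n" and s where
      dir: "descent_direction A \<eta> x u s" and in_spans: "\<forall>i. x i \<in> span (range (\<lambda>i. column i (X t)))"
        "\<forall>i. column i (X (Suc t)) \<in> span (range (geodesic_point x u s))"
      by blast
    then have xc: "x i \<in> span (range (c t))" and cy: "c (Suc t) i \<in> span (range (geodesic_point x u s))" for i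
      by (simp_all add: c_def)
    have x: "orthonormal x" and u: "orthonormal u" using dir by (auto simp: descent_direction_def)
    have y: "orthonormal (geodesic_point x u s)"
      by (rule orthonormal_geodesic_point(1)[OF x u tangent[OF dir assms(10) \<eta>]])
    have "gap x = D t" "\<bar>det (gram v x)\<bar> = p t"
      unfolding D_def p_def
      by (rule gap_change_of_frame[OF c x xc], rule abs_det_gram_change_of_frame[OF c x xc])
    moreover have "D (Suc t) = gap (geodesic_point x u s)" "p (Suc t) = \<bar>det (gram v (geodesic_point x u s))\<bar>"
      unfolding D_def p_def
      by (rule gap_change_of_frame[OF y c cy], rule abs_det_gram_change_of_frame[OF y c cy])
    ultimately show ?thesis
      using gap_descent[OF dir assms(10) \<eta>] overlap_step[OF dir assms(10) \<eta>]
        direction_le_gap[OF dir assms(10) \<eta>] assms(5)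
      by (intro exI[of _ "\<Sum>i\<in>UNIV. (s i)\<^sup>2"]) (simp add: sum_nonneg)
  qed
  then obtain q where q: "\<And>t. 0 \<le> q t" "\<And>t. D (Suc t) \<le> D t - q t / (2 * \<eta>)"
    "\<And>t. (1 + 2 * \<eta> * D t) * p t - q t \<le> p (Suc t)" "\<And>t. q t \<le> 2 * \<gamma> * \<eta>\<^sup>2 * D t"
    by metis
  have bound: "D t \<le> (2 * \<gamma> + 1 / \<eta>) / (4 * (a * real t + 1)) * d\<^sup>2" for t
  proof -
    have "p t \<le> 1" unfolding p_def by (rule det_gram_le_1[OF v c])
    moreover have "4 * \<eta> * (a * real t + 1) * D t + 2 * (1 - p t) \<le> 4 * \<eta> * D 0 + 2 * (1 - p 0)"
      using lyapunov_decrease[of a p \<eta> \<gamma> D q t] a p0 assms(10) \<eta>\<gamma> D0 q by auto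
    \<comment> \<open>Initially, \<open>1 - p\<close> is at most \<open>1 - cos d \<le> d\<^sup>2 / 2\<close>.\<close>
    moreover have "2 * (1 - p 0) \<le> d\<^sup>2" using p0 cos_ge_quadratic[of d] by (simp add: a_def)
    moreover have "4 * \<eta> * D 0 \<le> 2 * \<eta> * (\<gamma> * d\<^sup>2)"
      using mult_left_mono[OF D_init, of "2 * \<eta>"] assms(10) by simp
    ultimately have "4 * \<eta> * (a * real t + 1) * D t \<le> (2 * \<gamma> * \<eta> + 1) * d\<^sup>2"
      by (simp add: algebra_simps)
    moreover have pos: "0 < a * real t + 1" using a(1) by (intro add_nonneg_pos) auto
    ultimately have "D t \<le> (2 * \<gamma> * \<eta> + 1) * d\<^sup>2 / (4 * \<eta> * (a * real t + 1))"
      using assms(10) by (simp add: pos_le_divide_eq mult.commute)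
    also have "2 * \<gamma> * \<eta> + 1 = \<eta> * (2 * \<gamma> + 1 / \<eta>)"
      using assms(10) by (simp add: algebra_simps)
    also have "\<eta> * (2 * \<gamma> + 1 / \<eta>) * d\<^sup>2 / (4 * \<eta> * (a * real t + 1)) =
        (2 * \<gamma> + 1 / \<eta>) / (4 * (a * real t + 1)) * d\<^sup>2"
      using assms(10) by simp
    finally show ?thesis .
  qed
  have "(\<lambda>t. D t) \<in> O(\<lambda>t. 1 / real t)"
  proof (rule bigoI[where c = "(2 * \<gamma> + 1 / \<eta>) * d\<^sup>2 / (4 * a)"], rule eventually_mono[OF eventually_gt_at_top[of 0]])
    fix t :: nat assume t: "0 < t"
    have "D t \<le> (2 * \<gamma> + 1 / \<eta>) / (4 * (a * real t + 1)) * d\<^sup>2" by (rule bound)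
    also have "\<dots> \<le> (2 * \<gamma> + 1 / \<eta>) / (4 * (a * real t)) * d\<^sup>2"
      using a(1) t \<gamma> assms(10) by (intro mult_right_mono divide_left_mono) (auto intro!: mult_pos_pos add_nonneg_pos)
    finally show "norm (D t) \<le> (2 * \<gamma> + 1 / \<eta>) * d\<^sup>2 / (4 * a) * norm (1 / real t)"
      using D0[of t] by (simp add: field_simps)
  qed
  then show ?thesis using bound by (simp add: obj a_def d_def)
qed

end
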